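(* Let $p$ be a prime with $p\equiv1\pmod4$, and write $p=a^2+b^2$ with $a,b\in\mathbb Z$ and $a\equiv1\pmod4$. Then $$\sum_{k=0}^{\frac{p-1}2}\frac{\binom{2k}k^2}{8^k}\equiv\sum_{k=0}^{\frac{p-1}2}\frac{\binom{2k}k^2}{(-16)^k}\equiv P_{\frac{p-1}2}(3)\equiv(-1)^{\frac{p-1}4}\Big(2a-\frac p{2a}\Big)\pmod{p^2}.$$
   Context: Congruences are between rational numbers whose denominators are prime to $p$. $P_n(x)$ is the $n$-th Legendre polynomial, defined by $\frac1{\sqrt{1-2xt+t^2}}=\sum_{n\ge0}P_n(x)t^n$, equivalently $P_n(x)=\frac1{2^n}\sum_{k=0}^{[n/2]}\frac{(-1)^k(2n-2k)!}{k!(n-k)!(n-2k)!}x^{n-2k}$. *)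

theory Defs
  imports Complex_Main "HOL-Number_Theory.Number_Theory"
begin

definition legendreP :: "nat \<Rightarrow> 'a::field_char_0 \<Rightarrow> 'a" where
  "legendreP n x = (1 / 2 ^ n) * (\<Sum>k = 0..n div 2.
      (-1) ^ k * of_nat (fact (2*n - 2*k)) /
      (of_nat (fact k) * of_nat (fact (n - k)) * of_nat (fact (n - 2*k))) * x ^ (n - 2*k))"

definition p_integral :: "int \<Rightarrow> rat \<Rightarrow> bool" where
  "p_integral p r \<longleftrightarrow> coprime (snd (quotient_of r)) p"

definition rat_cong :: "int \<Rightarrow> int \<Rightarrow> rat \<Rightarrow> rat \<Rightarrow> bool" where
  "rat_cong p m x y \<longleftrightarrow> (\<exists>r. p_integral p r \<and> x - y = of_int m * r)"

end

theory Submission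
  imports Defs "HOL-Computational_Algebra.Polynomial" "HOL-Computational_Algebra.Formal_Power_Series"
begin

text \<open>Write \<open>p = 4 * N + 1\<close>. Modulo \<open>p\<^sup>2\<close> both binomial sums are the expansion
  \<open>P\<^sub>n(x) = (\<Sum>k. (n choose k) (n + k choose k) ((x - 1) / 2)^k)\<close> for \<open>n = 2 * N\<close>, at \<open>x = -3\<close> and \<open>x = 3\<close>.
  Let \<open>J\<close> be the Jacobi sum of a quartic and the quadratic character with values in \<open>\<int>/p\<^sup>2\<close>.
  Summing over Teichmueller representatives, whose power sums vanish modulo \<open>p\<^sup>2\<close>, expresses \<open>J\<close>
  through binomial coefficients and the numbers \<open>p / r\<close>; the coefficient of \<open>X^n\<close> in
  \<open>(1 - X\<^sup>2)^n / (1 - X)^p\<close> gives the same expression for \<open>-P\<^sub>n(3)\<close>, so \<open>P\<^sub>n(3) = -J\<close> modulo \<open>p\<^sup>2\<close>.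
  On the other hand \<open>J = (S 1 + i * S g) / 2\<close> with \<open>i\<^sup>2 = -1\<close> and Jacobsthal sums \<open>S\<close> satisfying
  \<open>(S 1)\<^sup>2 + (S g)\<^sup>2 = 4 * p\<close>, and \<open>S 1\<close> is known modulo \<open>8\<close>. Hence \<open>S 1 / 2 = -(-1)^N * a\<close>, and since \<open>p\<close> divides the
  conjugate of \<open>J\<close>, the equation \<open>z\<^sup>2 - S 1 * z + p = 0\<close> determines \<open>J\<close> modulo \<open>p\<^sup>2\<close>.\<close>

section \<open>Congruences and binomial identities\<close>

lemma sum_residues_affine:
  fixes f :: "int \<Rightarrow> 'a::comm_monoid_add" and m u v :: int
  assumes "m > 0" and "coprime u m" and per: "\<And>x y. [x = y] (mod m) \<Longrightarrow> f x = f y"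
  shows "(\<Sum>x\<in>{0..<m}. f (u * x + v)) = (\<Sum>x\<in>{0..<m}. f x)"
proof -
  have inj: "inj_on (\<lambda>x. (u * x + v) mod m) {0..<m}"
  proof (rule inj_onI)
    fix x y assume xy: "x \<in> {0..<m}" "y \<in> {0..<m}" "(u * x + v) mod m = (u * y + v) mod m"
    then have "[u * x + v = u * y + v] (mod m)" by (simp add: cong_def)
    then have "[u * x = u * y] (mod m)" by (rule cong_add_rcancel[THEN iffD1])
    then have "[x = y] (mod m)" using assms(2) by (simp add: cong_mult_lcancel)
    with xy show "x = y" by (auto simp: cong_def)
  qed
  have "(\<lambda>x. (u * x + v) mod m) ` {0..<m} \<subseteq> {0..<m}" using assms(1) by auto
  with inj have "(\<lambda>x. (u * x + v) mod m) ` {0..<m} = {0..<m}"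
    by (intro endo_inj_surj) auto
  with inj have bij: "bij_betw (\<lambda>x. (u * x + v) mod m) {0..<m} {0..<m}" by (simp add: bij_betw_def)
  have "(\<Sum>x\<in>{0..<m}. f x) = (\<Sum>x\<in>{0..<m}. f ((u * x + v) mod m))"
    by (rule sum.reindex_bij_betw[OF bij, symmetric])
  also have "\<dots> = (\<Sum>x\<in>{0..<m}. f (u * x + v))"
    by (intro sum.cong refl per) (simp add: cong_def)
  finally show ?thesis by simp
qed

lemma cong_uminus_iff_dvd_add: "[x = - y] (mod m) \<longleftrightarrow> m dvd x + y" for x y m :: int
  by (simp add: cong_iff_dvd_diff)

lemma cong_small_eq:
  fixes x y m :: int
  assumes "[x = y] (mod m)" "\<bar>x - y\<bar> < m"
  shows "x = y"
  using assms zdvd_not_zless[of "\<bar>x - y\<bar>" m] by (auto simp: cong_iff_dvd_diff)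

text \<open>Factor \<open>x^p - y^p\<close> as \<open>x - y\<close> times a sum of \<open>p\<close>
  terms, each congruent to \<open>y^(p - 1)\<close>: both factors are divisible by
  \<open>p\<close>.\<close>

lemma cong_power_prime:
  fixes x y :: int and p :: nat
  assumes "prime p" and "[x = y] (mod int p)"
  shows "[x ^ p = y ^ p] (mod int p ^ 2)"
proof -
  have "[(\<Sum>i<p. x ^ i * y ^ (p - Suc i)) = (\<Sum>i<p. y ^ i * y ^ (p - Suc i))] (mod int p)"
    by (intro cong_sum cong_mult cong_pow assms cong_refl)
  also have "(\<Sum>i<p. y ^ i * y ^ (p - Suc i)) = (\<Sum>i<p. y ^ (p - 1))"
    by (intro sum.cong) (auto simp flip: power_add)
  also have "\<dots> = int p * y ^ (p - 1)" by simp
  finally have "int p dvd (\<Sum>i<p. x ^ i * y ^ (p - Suc i))"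
    by (simp add: cong_def dvd_eq_mod_eq_0)
  then have "int p * int p dvd (x - y) * (\<Sum>i<p. x ^ i * y ^ (p - Suc i))"
    using assms(2) by (intro mult_dvd_mono) (simp_all add: cong_iff_dvd_diff)
  then show ?thesis
    by (simp add: cong_iff_dvd_diff power2_eq_square power_diff_sumr2 mult.commute)
qed

lemma fermat_int:
  fixes x :: int and p :: nat
  assumes "prime p"
  shows "[x ^ p = x] (mod int p)"
proof -
  have nat: "[k ^ p = k] (mod p)" for k :: nat
  proof (cases "p dvd k")
    case True
    then have "p dvd k ^ p" using prime_gt_0_nat[OF assms] by (metis dvd_power dvd_trans)
    with True show ?thesis by (simp add: cong_def dvd_eq_mod_eq_0)
  next
    case False
    then have "[k ^ (p - 1) * k = 1 * k] (mod p)"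
      by (intro cong_mult fermat_theorem assms cong_refl)
    then show ?thesis using prime_gt_0_nat[OF assms] by (simp flip: power_Suc2)
  qed
  define k where "k = nat (x mod int p)"
  have k: "[int k = x] (mod int p)"
    using prime_gt_0_nat[OF assms] by (simp add: k_def cong_def)
  have "[x ^ p = int k ^ p] (mod int p)" by (intro cong_pow cong_sym[OF k])
  also have "[int k ^ p = int k] (mod int p)" using nat[of k] by (metis cong_int_iff of_nat_power)
  finally show ?thesis using k by (rule cong_trans)
qed

text \<open>First-order Taylor expansion, since \<open>h * h\<close> vanishes modulo
  \<open>m ^ 2\<close>. At \<open>n = 0\<close> the truncated \<open>n - 1\<close> is harmless, its
  coefficient being 0.\<close>

lemma cong_binomial_linear:
  fixes y h m :: int
  assumes "m dvd h"
  shows "[(y + h) ^ n = y ^ n + of_nat n * y ^ (n - 1) * h] (mod m ^ 2)"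
proof (induction n)
  case (Suc n)
  have hh: "[h * h = 0] (mod m ^ 2)"
    using assms by (simp add: cong_0_iff power2_eq_square mult_dvd_mono)
  have "[(y + h) ^ Suc n = (y + h) * (y ^ n + of_nat n * y ^ (n - 1) * h)] (mod m ^ 2)"
    unfolding power_Suc by (intro cong_mult cong_refl Suc.IH)
  also have "(y + h) * (y ^ n + of_nat n * y ^ (n - 1) * h)
      = y ^ Suc n + of_nat (Suc n) * y ^ n * h + of_nat n * y ^ (n - 1) * (h * h)"
    by (cases n) (simp_all add: algebra_simps)
  also have "[y ^ Suc n + of_nat (Suc n) * y ^ n * h + of_nat n * y ^ (n - 1) * (h * h)
      = y ^ Suc n + of_nat (Suc n) * y ^ n * h + of_nat n * y ^ (n - 1) * 0] (mod m ^ 2)"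
    by (intro cong_add cong_mult cong_refl hh)
  finally show ?case by simp
qed simp

lemma one_minus_power_expand:
  fixes x :: "'a::comm_ring_1"
  shows "(1 - x) ^ n = (\<Sum>i\<le>n. of_nat (n choose i) * (-1) ^ i * x ^ i)"
  using binomial_ring[of "- x" 1 n] by (simp add: power_minus[of x] mult.assoc)

lemma central_choose_Suc: "(k + 1) * (2 * Suc k choose Suc k) = 2 * (2*k + 1) * (2*k choose k)"
proof -
  have "(k + 1) * (2 * Suc k choose Suc k) = 2 * ((k + 1) * (2*k + 1 choose k))"
    using binomial_absorption[of k "2 * Suc k"] by simp
  also have "(2*k + 1 choose k) = (2*k + 1 choose Suc k)"
    using binomial_symmetric[of k "2*k + 1"] by simp
  also have "(k + 1) * \<dots> = (2*k + 1) * (2*k choose k)"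
    using binomial_absorption[of k "2*k + 1"] by simp
  finally show ?thesis by simp
qed

text \<open>From \<open>(a*B - b*A) * (a*B + b*A) = p * (a^2 - A^2)\<close>, \<open>p\<close>
  divides one factor. By Brahmagupta's identity that factor is a leg of a right triangle with
  hypotenuse \<open>p\<close>; being even as well, it is 0 or at least \<open>2 * p\<close> in size,
  hence 0.\<close>

lemma sum_two_squares_odd_unique:
  fixes a b A B :: int and p :: nat
  assumes "prime p" "int p = a\<^sup>2 + b\<^sup>2" "int p = A\<^sup>2 + B\<^sup>2" "odd p" "odd a" "odd A"
  shows "A\<^sup>2 = a\<^sup>2"
proof -
  have zero: "X = 0" if X: "int p dvd X" "even X" "Y\<^sup>2 + X\<^sup>2 = (int p)\<^sup>2" for X Y :: int
  proof (rule ccontr)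
    assume "X \<noteq> 0"
    have "coprime (int p) 2" using \<open>odd p\<close> by simp
    then have "int p * 2 dvd X" using X(1,2) by (simp add: divides_mult)
    with \<open>X \<noteq> 0\<close> have "2 * int p \<le> \<bar>X\<bar>" using zdvd_imp_le[of "int p * 2" "\<bar>X\<bar>"] by simp
    then have "(2 * int p)\<^sup>2 \<le> X\<^sup>2" using power_mono[of "2 * int p" "\<bar>X\<bar>" 2] by simp
    moreover have "X\<^sup>2 \<le> (int p)\<^sup>2" using X(3) zero_le_power2[of Y] by linarith
    moreover have "(int p)\<^sup>2 > 0" using prime_gt_0_nat[OF assms(1)] by simp
    ultimately show False by (simp add: power_mult_distrib)
  qed
  have "odd (int p)" using \<open>odd p\<close> by simp
  then have "odd (a\<^sup>2 + b\<^sup>2)" "odd (A\<^sup>2 + B\<^sup>2)" using assms(2,3) by simp_all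
  then have "even b" "even B" using assms(5,6) by simp_all
  have "(a * B - b * A) * (a * B + b * A) = a\<^sup>2 * B\<^sup>2 - b\<^sup>2 * A\<^sup>2"
    by (simp add: power2_eq_square algebra_simps)
  also have "\<dots> = a\<^sup>2 * (int p - A\<^sup>2) - (int p - a\<^sup>2) * A\<^sup>2"
    using assms(2,3) by simp
  finally have prod: "(a * B - b * A) * (a * B + b * A) = int p * (a\<^sup>2 - A\<^sup>2)"
    by (simp add: algebra_simps)
  then have "int p dvd a * B - b * A \<or> int p dvd a * B + b * A"
    using assms(1) by (metis dvd_triv_left prime_dvd_mult_iff prime_nat_int_transfer)
  moreover have "(a * A + b * B)\<^sup>2 + (a * B - b * A)\<^sup>2 = (int p)\<^sup>2"
    unfolding power2_eq_square[of "int p"] by (subst assms(2), subst assms(3)) (simp add: power2_eq_square algebra_simps)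
  moreover have "(a * A - b * B)\<^sup>2 + (a * B + b * A)\<^sup>2 = (int p)\<^sup>2"
    unfolding power2_eq_square[of "int p"] by (subst assms(2), subst assms(3)) (simp add: power2_eq_square algebra_simps)
  ultimately have "a * B - b * A = 0 \<or> a * B + b * A = 0"
    using zero[of "a * B - b * A"] zero[of "a * B + b * A"] \<open>even b\<close> \<open>even B\<close> by auto
  then have "int p * (a\<^sup>2 - A\<^sup>2) = 0" using prod by auto
  then show ?thesis using prime_gt_0_nat[OF assms(1)] by simp
qed

text \<open>Both sides are the coefficient of \<open>X^n\<close> in
  \<open>(1 + X)^n / (1 - X)^(n + 1) = (1 - X\<^sup>2)^n / (1 - X)^(2 * n + 1)\<close>.\<close>
lemma sum_choose_mult_choose:
  includes fps_syntax
  shows "(\<Sum>k\<le>n. int (n choose k) * int (n + k choose k))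
    = (\<Sum>k\<le>n div 2. (-1) ^ k * int (n choose k) * int (2*n + (n - 2*k) choose (n - 2*k)))"
proof -
  \<comment> \<open>\<open>G m\<close> is the expansion of \<open>1 / (1 - X)^(m + 1)\<close>,
    handled by products only so that everything stays over the integers.\<close>
  define G where "G m = Abs_fps (\<lambda>k. int (m + k choose k))" for m
  have G_Suc: "(1 - fps_X) * G (Suc m) = G m" for m
  proof (rule fps_ext)
    fix k show "((1 - fps_X) * G (Suc m)) $ k = G m $ k"
      by (cases k) (simp_all add: G_def left_diff_distrib)
  qed
  have G_add: "(1 - fps_X) ^ j * G (m + j) = G m" for j m
    by (induction j) (simp_all add: mult.assoc[of _ "(1 - fps_X) ^ _"] G_Suc mult.left_commute[of "1 - fps_X"])
  have "(1 + fps_X) ^ n * G n = (1 + fps_X) ^ n * ((1 - fps_X) ^ n * G (2 * n))"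
    using G_add[of n n] by (simp add: mult_2)
  also have "\<dots> = (1 - fps_X\<^sup>2) ^ n * G (2 * n)"
    by (simp add: power2_eq_square algebra_simps flip: power_mult_distrib mult.assoc)
  finally have eq: "((1 + fps_X) ^ n * G n) $ n = ((1 - fps_X\<^sup>2) ^ n * G (2 * n)) $ n" by simp
  have lhs: "((1 + fps_X) ^ n * G n) $ n = (\<Sum>k\<le>n. int (n choose k) * int (n + k choose k))"
    unfolding binomial_ring sum_distrib_right fps_sum_nth
    by (intro sum.cong refl) (simp add: mult.assoc fps_X_power_mult_nth G_def)
  have "((1 - fps_X\<^sup>2) ^ n * G (2 * n)) $ n
      = (\<Sum>k\<le>n. int (n choose k) * (-1) ^ k * (if n < 2*k then 0 else int (2*n + (n - 2*k) choose (n - 2*k))))"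
    unfolding one_minus_power_expand sum_distrib_right fps_sum_nth
  proof (intro sum.cong refl)
    fix k
    have c: "of_nat (n choose k) * (-1) ^ k * (fps_X\<^sup>2) ^ k * G (2 * n)
      = fps_const (int (n choose k) * (-1) ^ k) * (fps_X ^ (2*k) * G (2 * n))"
      by (simp add: fps_of_nat[symmetric] minus_one_power_iff mult.assoc flip: power_mult)
    show "(of_nat (n choose k) * (-1) ^ k * (fps_X\<^sup>2) ^ k * G (2 * n)) $ n
      = int (n choose k) * (-1) ^ k * (if n < 2*k then 0 else int (2*n + (n - 2*k) choose (n - 2*k)))"
      unfolding c by (simp add: fps_X_power_mult_nth G_def)
  qed
  also have "\<dots> = (\<Sum>k\<le>n div 2. (-1) ^ k * int (n choose k) * int (2*n + (n - 2*k) choose (n - 2*k)))"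
    by (intro sum.mono_neutral_cong_right) (auto simp: mult_ac)
  finally show ?thesis using lhs eq by simp
qed

text \<open>Rodrigues' formula without derivatives: \<open>2^n\<close> times either side is the
  coefficient of \<open>X^n\<close> in \<open>((x + X)^2 - 1)^n\<close>. Expanding in powers of
  \<open>(x + X)^2\<close> gives the definition; the factorisation \<open>L * (L + 2)\<close> with
  \<open>L = X + x - 1\<close> gives the sum.\<close>

lemma legendreP_eq:
  fixes x :: "'a::field_char_0"
  shows "legendreP n x = (\<Sum>k\<le>n. of_nat (n choose k) * of_nat (n + k choose k) * ((x - 1) / 2) ^ k)"
proof -
  define L where "L = [:x - 1, 1:]"
  have "([:x, 1:]\<^sup>2 + - 1) = L * (L + [:2:])" by (simp add: L_def power2_eq_square one_pCons algebra_simps)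
  then have "coeff (([:x, 1:]\<^sup>2 + - 1) ^ n) n = coeff (L ^ n * (L + [:2:]) ^ n) n"
    by (simp add: power_mult_distrib)
  also have "coeff (([:x, 1:]\<^sup>2 + - 1) ^ n) n = coeff ((- 1 + [:x, 1:]\<^sup>2) ^ n) n"
    by (simp add: add.commute)
  also have "\<dots> = (\<Sum>k\<le>n. of_nat (n choose k) * (-1) ^ k * coeff ([:x, 1:] ^ (2*n - 2*k)) n)"
    unfolding binomial_ring coeff_sum
  proof (intro sum.cong refl)
    fix k
    have "of_nat (n choose k) * (- 1) ^ k * ([:x, 1:]\<^sup>2) ^ (n - k)
      = smult (of_nat (n choose k) * (-1) ^ k) ([:x, 1:] ^ (2*n - 2*k))"
      by (simp add: of_nat_mult_conv_smult minus_one_power_iff right_diff_distrib' flip: power_mult)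
    then show "coeff (of_nat (n choose k) * (- 1) ^ k * ([:x, 1:]\<^sup>2) ^ (n - k)) n
      = of_nat (n choose k) * (-1) ^ k * coeff ([:x, 1:] ^ (2*n - 2*k)) n"
      by simp
  qed
  also have "\<dots> = (\<Sum>k=0..n div 2. of_nat (n choose k) * (-1) ^ k * (of_nat (2*n - 2*k choose n) * x ^ (n - 2*k)))"
  \<comment> \<open>Beyond \<open>n div 2\<close> the degree \<open>2*n - 2*k\<close> is below
    \<open>n\<close>, so these coefficients vanish.\<close>
  proof (intro sum.mono_neutral_cong_right ballI)
    fix k assume "k \<in> {..n} - {0..n div 2}"
    then have "2*n - 2*k < n" unfolding Diff_iff atMost_iff atLeastAtMost_iff by presburger
    then have "degree ([:x, 1:] ^ (2*n - 2*k)) < n" by (simp add: degree_linear_power)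
    then show "of_nat (n choose k) * (-1) ^ k * coeff ([:x, 1:] ^ (2*n - 2*k)) n = 0"
      by (simp add: coeff_eq_0)
  next
    fix k assume "k \<in> {0..n div 2}"
    then have "n \<le> 2*n - 2*k" "2*n - 2*k - n = n - 2*k" by auto
    then show "of_nat (n choose k) * (-1) ^ k * coeff ([:x, 1:] ^ (2*n - 2*k)) n
      = of_nat (n choose k) * (-1) ^ k * (of_nat (2*n - 2*k choose n) * x ^ (n - 2*k))"
      by (simp add: coeff_linear_poly_power)
  qed auto
  also have "\<dots> = 2 ^ n * legendreP n x"
    unfolding legendreP_def
  proof (simp, intro sum.cong refl)
    fix k assume "k \<in> {0..n div 2}"
    then have k: "k \<le> n" "n \<le> 2*n - 2*k" "2*n - 2*k - n = n - 2*k" by auto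
    have b: "(of_nat (2*n - 2*k choose n) :: 'a) = fact (2*n - 2*k) / (fact n * fact (n - 2*k))"
      unfolding binomial_fact[OF k(2)] k(3) ..
    show "of_nat (n choose k) * (-1) ^ k * (of_nat (2*n - 2*k choose n) * x ^ (n - 2*k))
      = (-1) ^ k * fact (2*n - 2*k) * x ^ (n - 2*k) / (fact k * fact (n - k) * fact (n - 2*k))"
      unfolding b binomial_fact[OF k(1)] by (simp add: mult_ac)
  qed
  also have "coeff (L ^ n * (L + [:2:]) ^ n) n = (\<Sum>k\<le>n. of_nat (n choose k) * (2 ^ (n - k) * coeff (L ^ (n + k)) n))"
    unfolding binomial_ring sum_distrib_left coeff_sum
  proof (intro sum.cong refl)
    fix k
    have "L ^ n * (of_nat (n choose k) * L ^ k * [:2:] ^ (n - k)) = of_nat (n choose k) * ([:2 ^ (n - k):] * L ^ (n + k))"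
      by (simp only: poly_const_pow power_add mult_ac)
    also have "\<dots> = smult (of_nat (n choose k) * 2 ^ (n - k)) (L ^ (n + k))"
      by (simp add: of_nat_mult_conv_smult mult.commute)
    finally show "coeff (L ^ n * (of_nat (n choose k) * L ^ k * [:2:] ^ (n - k))) n
        = of_nat (n choose k) * (2 ^ (n - k) * coeff (L ^ (n + k)) n)"
      by simp
  qed
  \<comment> \<open>The coefficient of \<open>X^n\<close> in \<open>L^(n + k)\<close> is
    \<open>(n + k choose n) * (x - 1)^k\<close>; the missing \<open>2^k\<close> becomes the
    denominator.\<close>
  also have "\<dots> = 2 ^ n * (\<Sum>k\<le>n. of_nat (n choose k) * of_nat (n + k choose k) * ((x - 1) / 2) ^ k)"
    unfolding sum_distrib_left
  proof (intro sum.cong refl)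
    fix k assume "k \<in> {..n}"
    then have pow: "(2::'a) ^ n = 2 ^ (n - k) * 2 ^ k" by (simp flip: power_add)
    have sym: "(n + k choose n) = (n + k choose k)" using binomial_symmetric[of n "n + k"] by simp
    show "of_nat (n choose k) * (2 ^ (n - k) * coeff (L ^ (n + k)) n)
      = 2 ^ n * (of_nat (n choose k) * of_nat (n + k choose k) * ((x - 1) / 2) ^ k)"
      unfolding pow by (simp add: L_def coeff_linear_poly_power sym power_divide)
  qed
  finally show ?thesis by simp
qed

text \<open>All exponents \<open>n - 2*k\<close> are even. This moves the value at -3, produced by
  the sum with base 8, to 3.\<close>

lemma legendreP_minus: "even n \<Longrightarrow> legendreP n (- x) = legendreP n x"
  unfolding legendreP_def by (intro arg_cong2[where f = "(*)"] sum.cong refl) (auto intro: power_minus_even)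

section \<open>Rational numbers integral at a prime and their congruences\<close>

text \<open>The fraction need not be reduced: with reduced form \<open>c / d\<close>,
  \<open>x * d = c * y\<close>, so \<open>p\<close> dividing \<open>d\<close> would divide
  \<open>c\<close> too.\<close>

lemma p_integralI:
  assumes "prime p" "\<not> p dvd y"
  shows "p_integral p (of_int x / of_int y)"
proof -
  obtain c d where cd: "quotient_of (of_int x / of_int y) = (c, d)" by force
  have "d > 0" using cd by (rule quotient_of_denom_pos)
  have y: "y \<noteq> 0" using assms by auto
  have "(of_int x / of_int y :: rat) = of_int c / of_int d" using cd by (rule quotient_of_div)
  then have "(of_int (x * d) :: rat) = of_int (c * y)" using y \<open>d > 0\<close> by (simp add: field_simps)
  then have eq: "x * d = c * y" by (simp only: of_int_eq_iff)
  have "\<not> p dvd d"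
  proof
    assume "p dvd d"
    then have "p dvd c * y" using eq by (metis dvd_mult)
    then have "p dvd c" using assms by (simp add: prime_dvd_mult_iff)
    with \<open>p dvd d\<close> have "p dvd 1" using quotient_of_coprime[OF cd] by (metis coprime_common_divisor)
    then show False using assms(1) not_prime_unit by blast
  qed
  then show ?thesis unfolding p_integral_def cd
    using assms(1) by (metis coprime_commute prime_imp_coprime snd_conv)
qed

lemma p_integralE:
  assumes "prime p" "p_integral p r"
  obtains x y where "r = of_int x / of_int y" "\<not> p dvd y"
proof -
  obtain c d where cd: "quotient_of r = (c, d)" by force
  have "coprime d p" using assms(2) by (simp add: p_integral_def cd)
  then have "\<not> p dvd d" using assms(1)
    by (metis coprime_common_divisor dvd_refl not_prime_unit)
  then show ?thesis using that quotient_of_div[OF cd] by blast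
qed

lemma p_integral_add:
  assumes "prime p" "p_integral p r" "p_integral p s"
  shows "p_integral p (r + s)"
proof -
  obtain x y where r: "r = of_int x / of_int y" "\<not> p dvd y" using assms by (elim p_integralE)
  obtain z w where s: "s = of_int z / of_int w" "\<not> p dvd w" using assms by (elim p_integralE)
  have "y \<noteq> 0" "w \<noteq> 0" using r s by auto
  then have "r + s = of_int (x * w + z * y) / of_int (y * w)" using r s by (simp add: field_simps)
  then show ?thesis using r s assms(1) by (metis p_integralI prime_dvd_mult_iff)
qed

text \<open>Cross-multiplication; this is how integer congruences below are transferred to
  rationals.\<close>

lemma rat_congI:
  assumes "prime p" "\<not> p dvd y" "\<not> p dvd w" "[x * w = z * y] (mod m)"
  shows "rat_cong p m (of_int x / of_int y) (of_int z / of_int w)"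
proof -
  obtain q where q: "x * w - z * y = m * q" using assms(4) by (auto simp: cong_iff_dvd_diff)
  have "y \<noteq> 0" "w \<noteq> 0" using assms by auto
  then have "(of_int x / of_int y - of_int z / of_int w :: rat) = of_int (x * w - z * y) / of_int (y * w)"
    by (simp add: field_simps)
  also have "\<dots> = of_int m * (of_int q / of_int (y * w))" by (simp add: q)
  finally show ?thesis unfolding rat_cong_def
    using p_integralI[of p "y * w" q] assms by (metis prime_dvd_mult_iff)
qed

lemma rat_cong_refl: "prime p \<Longrightarrow> rat_cong p m x x"
  unfolding rat_cong_def using p_integralI[of p 1 0] not_prime_unit[of p] by (intro exI[of _ 0]) auto

lemma rat_cong_add:
  "prime p \<Longrightarrow> rat_cong p m x y \<Longrightarrow> rat_cong p m x' y' \<Longrightarrow> rat_cong p m (x + x') (y + y')"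
  unfolding rat_cong_def
  by (elim exE conjE, rule_tac x = "r + ra" in exI) (simp add: p_integral_add algebra_simps)

lemma rat_cong_sum:
  assumes "prime p" "\<And>i. i \<in> I \<Longrightarrow> rat_cong p m (f i) (g i)"
  shows "rat_cong p m (sum f I) (sum g I)"
  using assms(2) by (induction I rule: infinite_finite_induct)
    (auto intro: rat_cong_add rat_cong_refl assms(1))

lemma rat_cong_sym:
  assumes "prime p" "rat_cong p m x y"
  shows "rat_cong p m y x"
proof -
  obtain r where r: "p_integral p r" "x - y = of_int m * r" using assms by (auto simp: rat_cong_def)
  obtain u v where "r = of_int u / of_int v" "\<not> p dvd v" using assms(1) r(1) by (elim p_integralE)
  then have "p_integral p (- r)" using p_integralI[OF assms(1), of v "- u"] by simp
  moreover have "y - x = of_int m * (- r)" using r(2) by (simp add: algebra_simps)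
  ultimately show ?thesis by (auto simp: rat_cong_def)
qed

lemma rat_cong_trans:
  assumes "prime p" "rat_cong p m x y" "rat_cong p m y z"
  shows "rat_cong p m x z"
proof -
  obtain r s where "p_integral p r" "x - y = of_int m * r" "p_integral p s" "y - z = of_int m * s"
    using assms by (auto simp: rat_cong_def)
  then have "p_integral p (r + s)" "x - z = of_int m * (r + s)"
    using assms(1) by (auto simp: p_integral_add algebra_simps)
  then show ?thesis by (auto simp: rat_cong_def)
qed

section \<open>Jacobsthal sums\<close>

locale prime_1_mod_4 =
  fixes p N :: nat
  assumes prime_p: "prime p" and p_eq: "p = 4 * N + 1"
begin

definition rho :: "int \<Rightarrow> int" where "rho x = Legendre x (int p)"

abbreviation R :: "int set" where "R \<equiv> {0..<int p}"

lemma N_pos: "N > 0"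
  using prime_p p_eq by (cases N) auto

lemma p_gt: "p > 4" using N_pos p_eq by simp

lemma N_eq: "(p - 1) div 2 = 2 * N" using p_eq by simp

lemma prime_int_p: "prime (int p)" using prime_p by simp

lemma coprime_iff: "coprime x (int p) \<longleftrightarrow> \<not> int p dvd x"
  using prime_int_p
  by (metis coprime_absorb_right coprime_commute not_prime_unit prime_imp_coprime)

lemma rho_euler: "[rho x = x ^ (2 * N)] (mod int p)"
  using euler_criterion[of p x, unfolded N_eq] prime_p p_gt by (simp add: rho_def)

lemma rho_cases: "rho x = 0 \<or> rho x = 1 \<or> rho x = -1"
  by (auto simp: rho_def Legendre_def)

text \<open>The values -1, 0, 1 differ by at most 2, less than \<open>p\<close>; so identities
  between characters can be checked modulo \<open>p\<close> by Euler's criterion.\<close>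

lemma rho_eqI:
  assumes "[rho x = y] (mod int p)" "y \<in> {-1, 0, 1}"
  shows "rho x = y"
  using assms p_gt rho_cases[of x] by (intro cong_small_eq[OF assms(1)]) auto

lemma rho_cong: "[x = y] (mod int p) \<Longrightarrow> rho x = rho y"
  using rho_cases[of y]
  by (intro rho_eqI) (auto intro: cong_trans[OF rho_euler] cong_trans[OF cong_pow] cong_sym[OF rho_euler])

lemma rho_mult: "rho (x * y) = rho x * rho y"
proof (rule rho_eqI)
  have "[rho (x * y) = x ^ (2 * N) * y ^ (2 * N)] (mod int p)"
    using rho_euler[of "x * y"] by (simp add: power_mult_distrib)
  also have "[x ^ (2 * N) * y ^ (2 * N) = rho x * rho y] (mod int p)"
    by (intro cong_mult cong_sym[OF rho_euler])
  finally show "[rho (x * y) = rho x * rho y] (mod int p)" .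
  show "rho x * rho y \<in> {-1, 0, 1}" using rho_cases[of x] rho_cases[of y] by auto
qed

lemma rho_eq_0_iff: "rho x = 0 \<longleftrightarrow> int p dvd x"
  by (auto simp: rho_def Legendre_def cong_0_iff)

lemma rho_0 [simp]: "rho 0 = 0" by (simp add: rho_eq_0_iff)

lemma rho_1 [simp]: "rho 1 = 1"
  by (rule rho_eqI) (use rho_euler[of 1] in auto)

text \<open>The Euler exponent \<open>2 * N\<close> is even because \<open>p\<close> is 1 modulo
  4.\<close>

lemma rho_minus_1 [simp]: "rho (-1) = 1"
  by (rule rho_eqI) (use rho_euler[of "-1"] in auto)

lemma rho_minus [simp]: "rho (- x) = rho x"
  using rho_mult[of "-1" x] by simp

lemma rho_diff_commute: "rho (x - y) = rho (y - x)"
  using rho_minus[of "x - y"] by simp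

lemma rho_square: "\<not> int p dvd x \<Longrightarrow> rho x * rho x = 1"
  using rho_cases[of x] by (auto simp: rho_eq_0_iff)

lemma rho_R_0: "x \<in> R \<Longrightarrow> rho x = 0 \<longleftrightarrow> x = 0"
  using zdvd_not_zless[of x "int p"] by (cases "x > 0") (auto simp: rho_eq_0_iff)

lemma sum_affine:
  fixes f :: "int \<Rightarrow> 'a::comm_monoid_add"
  assumes "\<not> int p dvd u" "\<And>x y. [x = y] (mod int p) \<Longrightarrow> f x = f y"
  shows "(\<Sum>x\<in>R. f (u * x + v)) = (\<Sum>x\<in>R. f x)"
  using assms p_gt by (intro sum_residues_affine) (auto simp: coprime_iff)

lemma sum_scale:
  fixes f :: "int \<Rightarrow> 'a::comm_monoid_add"
  assumes "\<not> int p dvd u" "\<And>x y. [x = y] (mod int p) \<Longrightarrow> f x = f y"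
  shows "(\<Sum>x\<in>R. f (u * x)) = (\<Sum>x\<in>R. f x)"
  using sum_affine[of u f 0] assms by simp

lemma sum_shift:
  fixes f :: "int \<Rightarrow> 'a::comm_monoid_add"
  assumes "\<And>x y. [x = y] (mod int p) \<Longrightarrow> f x = f y"
  shows "(\<Sum>x\<in>R. f (x + v)) = (\<Sum>x\<in>R. f x)"
  using sum_affine[of 1 f v] assms prime_int_p not_prime_unit by fastforce

section \<open>A primitive root and its Teichmueller lift\<close>

definition g :: nat where "g = (SOME g. residue_primroot p g)"

lemma primroot_g: "residue_primroot p g"
  unfolding g_def using prime_primitive_root_exists[of p] prime_p prime_gt_1_nat[OF prime_p]
  by (intro someI_ex[of "residue_primroot p"]) auto

text \<open>The Teichmueller representative of \<^term>\<open>g\<close> modulo \<open>p\<^sup>2\<close>.\<close>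
definition t :: int where "t = int g ^ p"

lemma ord_g: "ord p g = 4 * N"
  using primroot_g prime_p p_eq totient_prime[OF prime_p] by (simp add: residue_primroot_def)

lemma g_not_dvd: "\<not> int p dvd int g"
  using primroot_g prime_p by (auto simp: residue_primroot_def coprime_commute
    dest: coprime_common_divisor[where c = p])

lemma t_cong_g: "[t = int g] (mod int p)"
  unfolding t_def by (rule fermat_int[OF prime_p])

lemma t_not_dvd: "\<not> int p dvd t"
  using g_not_dvd t_cong_g by (simp add: cong_dvd_iff)

text \<open>The \<open>p\<close>-th power lifts Euler's criterion from \<open>p\<close> to
  \<open>p^2\<close>, and \<open>rho x\<close> is its own \<open>p\<close>-th power as
  \<open>p\<close> is odd. So a polynomial expression represents the character modulo
  \<open>p^2\<close>.\<close>

lemma rho_pow_p: "[x ^ (2 * N * p) = rho x] (mod int p ^ 2)"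
proof -
  have "[(x ^ (2 * N)) ^ p = rho x ^ p] (mod int p ^ 2)"
    by (intro cong_power_prime prime_p cong_sym[OF rho_euler])
  moreover have "rho x ^ p = rho x" using rho_cases[of x] p_eq by auto
  ultimately show ?thesis by (simp add: power_mult)
qed

text \<open>\<open>t\<close> has the order of \<open>g\<close>. The modulus is \<open>p\<close>, not
  \<open>p^2\<close>, so that \<open>t^j - 1\<close> is a unit modulo \<open>p^2\<close> whenever
  \<open>4 * N\<close> does not divide \<open>j\<close>.\<close>

lemma t_pow_cong_1_iff: "[t ^ k = 1] (mod int p) \<longleftrightarrow> 4 * N dvd k"
proof -
  have "[t ^ k = 1] (mod int p) \<longleftrightarrow> [int g ^ k = 1] (mod int p)"
    using cong_pow[OF t_cong_g, of k] by (meson cong_sym cong_trans)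
  also have "\<dots> \<longleftrightarrow> [g ^ k = 1] (mod p)" by (metis cong_int_iff of_nat_1 of_nat_power)
  also have "\<dots> \<longleftrightarrow> 4 * N dvd k" by (simp add: ord_divides ord_g flip: One_nat_def)
  finally show ?thesis .
qed

lemma t_pow_rho: "[t ^ (2 * N) = rho (int g)] (mod int p ^ 2)"
  using rho_pow_p[of "int g"] by (simp add: t_def mult.commute flip: power_mult)

text \<open>A primitive root is a nonresidue: \<open>2 * N\<close> is not a multiple of its order
  \<open>4 * N\<close>.\<close>

lemma rho_g [simp]: "rho (int g) = -1"
proof -
  have "\<not> [t ^ (2 * N) = 1] (mod int p)" using N_pos t_pow_cong_1_iff[of "2 * N"] by (auto dest: dvd_imp_le)
  moreover have "[t ^ (2 * N) = rho (int g)] (mod int p)"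
    using t_pow_rho by (rule cong_dvd_modulus) simp
  ultimately show ?thesis using rho_cases[of "int g"] g_not_dvd by (auto simp: rho_eq_0_iff)
qed

lemma rho_t [simp]: "rho t = -1"
  using rho_cong[OF t_cong_g] by simp

lemma rho_t_pow: "rho (t ^ k) = (-1) ^ k"
  by (induction k) (auto simp: rho_mult)

lemma t_pow_2N: "[t ^ (2 * N) = -1] (mod int p ^ 2)"
  using t_pow_rho by simp

lemma t_pow_4N: "[t ^ (4 * N) = 1] (mod int p ^ 2)"
  using cong_pow[OF t_pow_2N, of 2] by (simp flip: power_mult)

lemma sum_t_pow:
  fixes f :: "int \<Rightarrow> 'a::comm_monoid_add"
  assumes per: "\<And>x y. [x = y] (mod int p) \<Longrightarrow> f x = f y"
  shows "(\<Sum>k<4*N. f (t ^ k)) = (\<Sum>x\<in>R - {0}. f x)"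
proof -
  have bij: "bij_betw (\<lambda>i. g ^ i mod p) {..<4*N} {0<..<p}"
    using residue_primroot_is_generator[OF _ primroot_g] prime_p p_eq prime_gt_1_nat[OF prime_p]
    by (simp add: totient_prime totatives_prime)
  have bij2: "bij_betw int {0<..<p} (R - {0})"
    by (rule bij_betwI[where g = nat]) auto
  have "(\<Sum>x\<in>R - {0}. f x) = (\<Sum>k<4*N. f (int (g ^ k mod p)))"
    using sum.reindex_bij_betw[OF bij_betw_trans[OF bij bij2], of f] by simp
  also have "\<dots> = (\<Sum>k<4*N. f (t ^ k))"
  proof (intro sum.cong refl per)
    fix k
    have "[int (g ^ k mod p) = int g ^ k] (mod int p)" by (simp add: cong_def zmod_int)
    also have "[int g ^ k = t ^ k] (mod int p)" by (intro cong_pow cong_sym[OF t_cong_g])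
    finally show "[int (g ^ k mod p) = t ^ k] (mod int p)" .
  qed
  finally show ?thesis by simp
qed

section \<open>Complete sums of the quadratic character\<close>

lemma sum_R_minus_0:
  fixes f :: "int \<Rightarrow> int"
  shows "(\<Sum>x\<in>R - {0}. f x) = (\<Sum>x\<in>R. f x) - f 0"
  using p_gt by (subst sum_diff1) auto

text \<open>Scaling by the nonresidue \<open>g\<close> permutes the residues and flips the
  sign.\<close>

lemma sum_rho: "(\<Sum>x\<in>R. rho x) = 0"
proof -
  have "(\<Sum>x\<in>R. rho x) = (\<Sum>x\<in>R. rho (int g * x))"
    by (rule sum_scale[symmetric]) (use g_not_dvd rho_cong in blast)+
  also have "\<dots> = - (\<Sum>x\<in>R. rho x)" by (simp add: rho_mult sum_negf)
  finally show ?thesis by simp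
qed

lemma sum_rho_shift: "(\<Sum>x\<in>R. rho (x + v)) = 0"
  using sum_shift[of rho v] sum_rho rho_cong by simp

lemma sum_rho_square: "(\<Sum>x\<in>R. rho x * rho x) = int p - 1"
proof -
  have "(\<Sum>x\<in>R. rho x * rho x) = (\<Sum>x\<in>R - {0}. rho x * rho x)" by (simp add: sum_R_minus_0)
  also have "\<dots> = (\<Sum>x\<in>R - {0}. 1)"
  proof (intro sum.cong refl rho_square)
    fix x assume "x \<in> R - {0}"
    then show "\<not> int p dvd x" using rho_R_0[of x] by (auto simp: rho_eq_0_iff)
  qed
  also have "\<dots> = int p - 1" using p_gt by (simp add: sum_R_minus_0 card_Diff_subset)
  finally show ?thesis .
qed

text \<open>For \<open>d\<close> prime to \<open>p\<close> the sum is independent of \<open>d\<close>, and the sum over all \<open>d\<close> vanishes.\<close>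
lemma sum_rho_translate:
  assumes "\<not> int p dvd d"
  shows "(\<Sum>x\<in>R. rho x * rho (x + d)) = -1"
proof -
  define W where "W d = (\<Sum>x\<in>R. rho x * rho (x + d))" for d
  have W_eq: "W d = W 1" if "\<not> int p dvd d" for d
  proof -
    have rho_dist: "rho (d * x + d) = rho d * rho (x + 1)" for x
      using rho_mult[of d "x + 1"] by (simp add: algebra_simps)
    have "W d = (\<Sum>x\<in>R. rho (d * x) * rho (d * x + d))"
      unfolding W_def
      by (rule sum_scale[where f = "\<lambda>x. rho x * rho (x + d)", symmetric, OF that])
         (auto intro!: arg_cong2[where f = "(*)"] rho_cong cong_add)
    also have "\<dots> = (\<Sum>x\<in>R. (rho d * rho d) * (rho x * rho (x + 1)))"
      unfolding rho_dist by (intro sum.cong refl) (simp add: rho_mult mult_ac)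
    also have "\<dots> = W 1" using that by (simp add: W_def rho_square)
    finally show ?thesis .
  qed
  have "0 = (\<Sum>x\<in>R. rho x * (\<Sum>d\<in>R. rho (d + x)))" by (simp add: sum_rho_shift)
  also have "\<dots> = (\<Sum>d\<in>R. W d)"
    unfolding W_def sum_distrib_left by (subst sum.swap) (simp add: add.commute)
  also have "\<dots> = W 0 + (\<Sum>d\<in>R - {0}. W d)" by (simp add: sum_R_minus_0)
  also have "(\<Sum>d\<in>R - {0}. W d) = (\<Sum>d\<in>R - {0}. W 1)"
    using rho_R_0 by (intro sum.cong refl W_eq) (auto simp: rho_eq_0_iff)
  also have "\<dots> = (int p - 1) * W 1" using p_gt by (simp add: card_Diff_subset)
  also have "W 0 = int p - 1" by (simp add: W_def sum_rho_square)
  finally have "(int p - 1) * (1 + W 1) = 0" by (simp only: distrib_left mult_1_right)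
  then have "W 1 = -1" using p_gt by auto
  then show ?thesis using W_eq[OF assms] by (simp add: W_def)
qed

lemma sum_rho_quadratic:
  "(\<Sum>x\<in>R. rho (x - u) * rho (x - v)) = (if [u = v] (mod int p) then int p else 0) - 1"
proof -
  have "(\<Sum>x\<in>R. rho (x - u) * rho (x - v)) = (\<Sum>x\<in>R. rho (x + u - u) * rho (x + u - v))"
    by (rule sum_shift[where f = "\<lambda>x. rho (x - u) * rho (x - v)", symmetric])
       (auto intro!: arg_cong2[where f = "(*)"] rho_cong cong_diff)
  also have "\<dots> = (\<Sum>x\<in>R. rho x * rho (x + (u - v)))" by (simp add: algebra_simps)
  also have "\<dots> = (if [u = v] (mod int p) then int p else 0) - 1"
  proof (cases "[u = v] (mod int p)")
    case True
    then have "(\<Sum>x\<in>R. rho x * rho (x + (u - v))) = (\<Sum>x\<in>R. rho x * rho x)"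
      by (intro sum.cong refl arg_cong2[where f = "(*)"] rho_cong)
         (auto simp: cong_iff_dvd_diff)
    then show ?thesis using True by (simp add: sum_rho_square)
  next
    case False
    then show ?thesis using sum_rho_translate[of "u - v"] by (simp add: cong_iff_dvd_diff)
  qed
  finally show ?thesis .
qed

text \<open>The Jacobsthal sum of \<open>x^3 - c * x\<close>; for \<open>c\<close> prime to
  \<open>p\<close> it is minus the Frobenius trace of the curve
  \<open>y^2 = x^3 - c * x\<close>.\<close>

definition S :: "int \<Rightarrow> int" where
  "S c = (\<Sum>x\<in>R. rho x * rho (x\<^sup>2 - c))"

lemma S_cong: "[c = d] (mod int p) \<Longrightarrow> S c = S d"
  unfolding S_def by (intro sum.cong refl arg_cong2[where f = "(*)"] rho_cong cong_diff) auto

text \<open>Substitute \<open>s * x\<close> for \<open>x\<close>. Up to sign, \<open>S\<close> thus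
  depends only on the square class of \<open>c\<close>, leaving \<open>S 1\<close> and
  \<open>S t\<close>.\<close>

lemma S_scale:
  assumes "\<not> int p dvd s"
  shows "S (c * s\<^sup>2) = rho s * S c"
proof -
  have "S (c * s\<^sup>2) = (\<Sum>x\<in>R. rho (s * x) * rho ((s * x)\<^sup>2 - c * s\<^sup>2))"
    unfolding S_def
    by (rule sum_scale[where f = "\<lambda>x. rho x * rho (x\<^sup>2 - c * s\<^sup>2)", symmetric, OF assms])
       (auto intro!: arg_cong2[where f = "(*)"] rho_cong cong_diff cong_pow)
  also have "\<dots> = (\<Sum>x\<in>R. rho s * (rho s * rho s) * (rho x * rho (x\<^sup>2 - c)))"
  proof (intro sum.cong refl)
    fix x
    have "(s * x)\<^sup>2 - c * s\<^sup>2 = s * s * (x\<^sup>2 - c)" by (simp add: power2_eq_square algebra_simps)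
    then show "rho (s * x) * rho ((s * x)\<^sup>2 - c * s\<^sup>2) = rho s * (rho s * rho s) * (rho x * rho (x\<^sup>2 - c))"
      by (simp add: rho_mult mult_ac)
  qed
  also have "\<dots> = rho s * S c" using assms by (simp add: S_def rho_square flip: sum_distrib_left)
  finally show ?thesis .
qed

text \<open>The solutions are \<open>x\<close> and \<open>p - x\<close>, distinct as
  \<open>p\<close> is odd; since -1 is a square, both contribute
  \<open>rho x * rho x * p = p\<close>.\<close>

lemma sum_rho_same_square:
  assumes "x \<in> R - {0}"
  shows "(\<Sum>y\<in>R. rho x * rho y * (if [x\<^sup>2 = y\<^sup>2] (mod int p) then int p else 0)) = 2 * int p"
proof -
  have nd: "\<not> int p dvd x" using assms rho_R_0[of x] by (auto simp: rho_eq_0_iff)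
  have "{y \<in> R. [x\<^sup>2 = y\<^sup>2] (mod int p)} = {x, int p - x}"
  proof (rule Set.set_eqI, rule iffI)
    fix y assume y: "y \<in> {y \<in> R. [x\<^sup>2 = y\<^sup>2] (mod int p)}"
    then have "int p dvd (x - y) * (x + y)"
      by (simp add: cong_iff_dvd_diff power2_eq_square algebra_simps)
    then have "int p dvd x - y \<or> int p dvd x + y"
      using prime_int_p by (simp add: prime_dvd_mult_iff)
    then show "y \<in> {x, int p - x}"
    proof
      assume "int p dvd x - y"
      then have "x = y" using assms y by (intro cong_small_eq[of x y "int p"]) (auto simp: cong_iff_dvd_diff)
      then show ?thesis by simp
    next
      assume "int p dvd x + y"
      then have "x = int p - y" using assms y
        by (intro cong_small_eq[of x _ "int p"]) (auto simp: cong_iff_dvd_diff algebra_simps)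
      then show ?thesis by simp
    qed
  next
    fix y assume "y \<in> {x, int p - x}"
    moreover have "[x\<^sup>2 = (int p - x)\<^sup>2] (mod int p)"
      by (auto simp: cong_iff_dvd_diff power2_eq_square algebra_simps)
    ultimately show "y \<in> {y \<in> R. [x\<^sup>2 = y\<^sup>2] (mod int p)}" using assms by auto
  qed
  moreover have "x \<noteq> int p - x" using p_eq by presburger
  moreover have "rho (int p - x) = rho x"
    using rho_cong[of "int p - x" "- x"] by (simp add: cong_iff_dvd_diff)
  ultimately show ?thesis using rho_square[OF nd]
    by (simp add: if_distrib[where f = "(*) _"] sum.If_cases Int_def cong: if_cong)
qed

text \<open>Expand the square and sum over \<open>c\<close> first. The inner sum is \<open>p\<close>
  on pairs with \<open>x^2 = y^2\<close>, minus the constant 1, whose contribution vanishes by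
  \<open>sum_rho\<close>.\<close>

lemma sum_S_square: "(\<Sum>c\<in>R. (S c)\<^sup>2) = 2 * int p * (int p - 1)"
proof -
  have "(\<Sum>c\<in>R. (S c)\<^sup>2)
      = (\<Sum>c\<in>R. \<Sum>x\<in>R. \<Sum>y\<in>R. rho x * rho y * (rho (c - x\<^sup>2) * rho (c - y\<^sup>2)))"
    unfolding S_def power2_eq_square[of "sum _ _"] sum_product
    by (intro sum.cong refl) (subst (1 2) rho_diff_commute[of "_ ^ 2"], simp add: mult_ac)
  also have "\<dots> = (\<Sum>x\<in>R. \<Sum>c\<in>R. \<Sum>y\<in>R. rho x * rho y * (rho (c - x\<^sup>2) * rho (c - y\<^sup>2)))"
    by (rule sum.swap)
  also have "\<dots> = (\<Sum>x\<in>R. \<Sum>y\<in>R. rho x * rho y * (\<Sum>c\<in>R. rho (c - x\<^sup>2) * rho (c - y\<^sup>2)))"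
    unfolding sum_distrib_left by (intro sum.cong refl sum.swap)
  also have "\<dots> = (\<Sum>x\<in>R. (\<Sum>y\<in>R. rho x * rho y * (if [x\<^sup>2 = y\<^sup>2] (mod int p) then int p else 0))
      - rho x * (\<Sum>y\<in>R. rho y))"
    unfolding sum_rho_quadratic
    by (simp add: right_diff_distrib sum_subtractf sum_distrib_left)
  also have "\<dots> = (\<Sum>x\<in>R. \<Sum>y\<in>R. rho x * rho y * (if [x\<^sup>2 = y\<^sup>2] (mod int p) then int p else 0))"
    by (simp add: sum_rho)
  also have "\<dots> = (\<Sum>x\<in>R - {0}. \<Sum>y\<in>R. rho x * rho y * (if [x\<^sup>2 = y\<^sup>2] (mod int p) then int p else 0))"
    by (subst sum_R_minus_0) simp
  also have "\<dots> = (\<Sum>x\<in>R - {0}. 2 * int p)"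
    by (rule sum.cong[OF refl sum_rho_same_square])
  also have "\<dots> = 2 * int p * (int p - 1)" using p_gt by (simp add: sum_R_minus_0 card_Diff_subset)
  finally show ?thesis .
qed

lemma sum_even_odd: "(\<Sum>k<4*N. f k) = (\<Sum>m<2*N. f (2*m) + f (2*m+1))" for f :: "nat \<Rightarrow> 'b::comm_monoid_add"
proof -
  have "(\<Sum>k<2*M. f k) = (\<Sum>m<M. f (2*m) + f (2*m+1))" for M
    by (induction M) (auto simp: add_ac)
  from this[of "2*N"] show ?thesis by simp
qed

lemma S_t_pow: "S (c * t ^ (2 * m)) = (-1) ^ m * S c"
proof -
  have "\<not> int p dvd t ^ m" using t_not_dvd prime_int_p prime_dvd_power by blast
  from S_scale[OF this, of c] show ?thesis by (simp add: rho_t_pow mult.commute flip: power_mult)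
qed

text \<open>\<open>S (t ^ k)^2\<close> depends only on the parity of \<open>k\<close>, so the second
  moment \<open>2 * p * (p - 1)\<close> consists of \<open>2 * N\<close> equal blocks.\<close>

lemma S_sum_squares: "(S 1)\<^sup>2 + (S t)\<^sup>2 = 4 * int p"
proof -
  have S0: "S 0 = 0"
  proof -
    have "S 0 = (\<Sum>x\<in>R. rho x)"
      unfolding S_def
    proof (intro sum.cong refl)
      fix x show "rho x * rho (x\<^sup>2 - 0) = rho x"
        using rho_cases[of x] by (auto simp: rho_mult power2_eq_square)
    qed
    then show ?thesis using sum_rho by simp
  qed
  have "2 * int p * (int p - 1) = (\<Sum>c\<in>R - {0}. (S c)\<^sup>2)"
    by (simp add: sum_R_minus_0 sum_S_square S0)
  also have "\<dots> = (\<Sum>k<4*N. (S (t ^ k))\<^sup>2)"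
    by (rule sum_t_pow[symmetric]) (simp add: S_cong)
  also have "\<dots> = (\<Sum>m<2*N. (S 1)\<^sup>2 + (S t)\<^sup>2)"
    unfolding sum_even_odd
  proof (intro sum.cong refl)
    fix m show "(S (t ^ (2*m)))\<^sup>2 + (S (t ^ (2*m+1)))\<^sup>2 = (S 1)\<^sup>2 + (S t)\<^sup>2"
      using S_t_pow[of 1 m] S_t_pow[of t m] by (simp add: power_mult_distrib flip: power_mult)
  qed
  also have "\<dots> = 2 * int N * ((S 1)\<^sup>2 + (S t)\<^sup>2)" by simp
  finally have "2 * int N * ((S 1)\<^sup>2 + (S t)\<^sup>2) = 2 * int N * (4 * int p)"
    using p_eq by (simp add: algebra_simps)
  then show ?thesis using N_pos by simp
qed

text \<open>Each summand with \<open>x \<noteq> 0, 1, -1\<close> of the sum below is \<open>0\<close> or \<open>8\<close>.\<close>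
lemma S_1_cong: "[S 1 = int p - 3] (mod 8)"
proof -
  define h where "h x = (1 - rho x) * (1 - rho (x + 1)) * (1 - rho (x + (-1)))" for x
  have per: "rho (int p + x) = rho x" for x by (rule rho_cong) (simp add: cong_def)
  have rm: "rho (int p - 1) = 1" "rho (int p - 2) = rho 2" "rho (int p) = 0"
    using per[of "-1"] per[of "-2"] per[of 0] by simp_all
  define T where "T = R - {0} - {1} - {int p - 1}"
  have sumT: "(\<Sum>x\<in>T. f x) = (\<Sum>x\<in>R. f x) - f 0 - f 1 - f (int p - 1)" for f :: "int \<Rightarrow> int"
    unfolding T_def using p_gt by (subst sum_diff1; auto)+
  have "8 dvd h x" if "x \<in> T" for x
  proof -
    have "rho x \<noteq> 0" "rho (x + 1) \<noteq> 0" "rho (x + (-1)) \<noteq> 0"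
      using that p_gt by (subst rho_R_0; auto simp: T_def)+
    then show ?thesis using rho_cases[of x] rho_cases[of "x+1"] rho_cases[of "x+(-1)"]
      by (auto simp: h_def)
  qed
  then have "8 dvd (\<Sum>x\<in>T. h x)" by (rule dvd_sum)
  also have "(\<Sum>x\<in>T. h x) = (\<Sum>x\<in>R. h x) - h 0 - h 1 - h (int p - 1)"
    by (rule sumT)
  \<comment> \<open>The omitted points contribute nothing, as 1 and -1 are squares.\<close>
  also have "h 0 = 0" by (simp add: h_def)
  also have "h 1 = 0" by (simp add: h_def)
  also have "h (int p - 1) = 0" by (simp add: h_def rm)
  \<comment> \<open>The triple product is the summand of \<open>S 1\<close>; linear terms sum to 0
    and each of the three pair products to -1. The shifts are written to match
    \<open>sum_rho_translate\<close> and \<open>sum_rho_quadratic\<close>.\<close>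
  also have "(\<Sum>x\<in>R. h x) = (\<Sum>x\<in>R. 1 - rho x - rho (x + 1) - rho (x + (-1))
     + rho x * rho (x + 1) + rho x * rho (x + (-1)) + rho (x - 1) * rho (x - (-1)) - rho x * rho (x\<^sup>2 - 1))"
  proof (intro sum.cong refl)
    fix x
    have "rho (x\<^sup>2 - 1) = rho (x + 1) * rho (x + (-1))"
      by (simp add: power2_eq_square algebra_simps flip: rho_mult)
    then show "h x = 1 - rho x - rho (x + 1) - rho (x + (-1))
     + rho x * rho (x + 1) + rho x * rho (x + (-1)) + rho (x - 1) * rho (x - (-1)) - rho x * rho (x\<^sup>2 - 1)"
      by (simp add: h_def algebra_simps)
  qed
  also have "\<dots> = int p - 3 - S 1"
  proof -
    have "\<not> int p dvd 1" "\<not> int p dvd -1" "\<not> [1 = -1] (mod int p)"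
      using p_gt zdvd_not_zless[of 1 "int p"] zdvd_not_zless[of 2 "int p"] by (auto simp: cong_iff_dvd_diff)
    then show ?thesis
      unfolding sum.distrib sum_subtractf sum_rho_shift sum_rho_quadratic
      by (simp add: sum_rho sum_rho_translate S_def del: add_uminus_conv_diff)
  qed
  finally show ?thesis by (simp add: cong_iff_dvd_diff dvd_diff_commute)
qed

section \<open>The Jacobi sum modulo the square of a prime\<close>

text \<open>\<open>e r\<close> represents \<open>p / r\<close> modulo \<open>p\<^sup>2\<close>.\<close>
definition e :: "nat \<Rightarrow> int" where "e r = (-1) ^ (r + 1) * int (p choose r)"

lemma int_p_eq: "int p = 4 * int N + 1" by (simp add: p_eq)

lemma dvd_p_choose: "0 < r \<Longrightarrow> r < p \<Longrightarrow> p dvd p choose r"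
  using prime_p by (intro dvd_choose_prime) (auto simp: prime_nat_iff)

lemma dvd_e: "0 < r \<Longrightarrow> r < p \<Longrightarrow> int p dvd e r"
  unfolding e_def using dvd_p_choose[of r] by (intro dvd_mult) (simp add: int_dvd_int_iff)

text \<open>Mirrors \<open>p / (p - s) = - p / s\<close> modulo \<open>p^2\<close>, but exactly: the
  sign flips because \<open>p\<close> is odd.\<close>

lemma e_reflect: "s \<le> p \<Longrightarrow> e (p - s) = - e s"
proof -
  assume s: "s \<le> p"
  have "even (p - s + 1) \<longleftrightarrow> even s" using p_eq s by presburger
  then have "(-1::int) ^ (p - s + 1) = (-1) ^ s" by (simp only: minus_one_power_iff)
  then show ?thesis using s by (simp add: e_def binomial_symmetric[of s p])
qed

lemma choose_p_minus_1: "k < p \<Longrightarrow> [int ((p - 1) choose k) = (-1) ^ k] (mod int p)"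
proof (induction k)
  case (Suc k)
  have "p choose Suc k = ((p - 1) choose k) + ((p - 1) choose Suc k)"
    using p_eq by simp
  then have "[int ((p - 1) choose Suc k) = - int ((p - 1) choose k)] (mod int p)"
    using dvd_p_choose[of "Suc k"] Suc.prems by (simp add: cong_iff_dvd_diff add.commute flip: of_nat_add)
  also have "[- int ((p - 1) choose k) = - ((-1) ^ k)] (mod int p)"
    using Suc by (simp add: cong_minus_minus_iff)
  finally show ?case by simp
qed simp

text \<open>Absorption gives \<open>r * (p choose r) = p * (p - 1 choose r - 1)\<close>; the extra
  \<open>p\<close> makes it enough to know the last binomial modulo \<open>p\<close>.\<close>

lemma mult_e: "0 < r \<Longrightarrow> r < p \<Longrightarrow> [int r * e r = int p] (mod int p ^ 2)"
proof -
  assume r: "0 < r" "r < p"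
  have "int r * e r = (-1) ^ (r + 1) * int (r * (p choose r))" by (simp add: e_def)
  also have "r * (p choose r) = p * ((p - 1) choose (r - 1))"
    using r times_binomial_minus1_eq[of r p] by simp
  finally have *: "int r * e r = int p * ((-1) ^ (r + 1) * int ((p - 1) choose (r - 1)))" by simp
  have "[(-1) ^ (r + 1) * int ((p - 1) choose (r - 1)) = (-1) ^ (r + 1) * (-1) ^ (r - 1)] (mod int p)"
    using r by (intro cong_mult cong_refl choose_p_minus_1) auto
  also have "(-1) ^ (r + 1) * (-1) ^ (r - 1) = (1::int)"
    using r by (cases r) simp_all
  finally have "int p * int p dvd int p * ((-1) ^ (r + 1) * int ((p - 1) choose (r - 1)) - 1)"
    by (intro mult_dvd_mono) (simp_all only: cong_iff_dvd_diff dvd_refl)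
  then show ?thesis unfolding *
    by (simp only: cong_iff_dvd_diff power2_eq_square right_diff_distrib mult_1_right)
qed

lemma one_minus_pow_p: "(1 - x) ^ p = 1 - x ^ p - (\<Sum>r\<in>{1..<p}. e r * x ^ r)" for x :: int
proof -
  have "{..p} = insert 0 (insert p {1..<p})" using p_gt by auto
  moreover have "odd p" using p_eq by simp
  ultimately show ?thesis unfolding one_minus_power_expand using p_gt
    by (simp add: e_def sum_negf mult_ac)
qed

text \<open>For a Teichmueller \<open>x\<close>, \<open>(1 - x)^p\<close> is \<open>1 - x\<close>
  plus a multiple of \<open>p\<close>; raise this to the power \<open>2 * N\<close> to first
  order.\<close>

lemma one_minus_pow_np:
  assumes "[x ^ p = x] (mod int p ^ 2)"
  shows "[(1 - x) ^ (2*N*p) = (1 - x) ^ (2*N)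
     - int (2*N) * (1 - x) ^ (2*N - 1) * (\<Sum>r\<in>{1..<p}. e r * x ^ r)] (mod int p ^ 2)"
proof -
  define h where "h = - (\<Sum>r\<in>{1..<p}. e r * x ^ r)"
  have h: "int p dvd h" unfolding h_def by (intro dvd_minus_iff[THEN iffD2] dvd_sum dvd_mult2 dvd_e) auto
  have "[(1 - x) ^ p = (1 - x) + h] (mod int p ^ 2)"
    unfolding one_minus_pow_p h_def using assms by (simp add: cong_iff_dvd_diff dvd_diff_commute)
  then have "[((1 - x) ^ p) ^ (2*N) = ((1 - x) + h) ^ (2*N)] (mod int p ^ 2)" by (rule cong_pow)
  also have "[((1 - x) + h) ^ (2*N) = (1 - x) ^ (2*N) + int (2*N) * (1 - x) ^ (2*N - 1) * h] (mod int p ^ 2)"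
    by (rule cong_binomial_linear[OF h])
  finally show ?thesis by (simp add: h_def mult.commute flip: power_mult)
qed

lemma t_pow_frob: "[(t ^ k) ^ p = t ^ k] (mod int p ^ 2)"
proof -
  have "[(t ^ (4 * N)) ^ k * t ^ k = 1 ^ k * t ^ k] (mod int p ^ 2)"
    by (intro cong_mult cong_pow t_pow_4N cong_refl)
  moreover have "(t ^ (4 * N)) ^ k * t ^ k = (t ^ k) ^ p"
    by (simp add: p_eq mult.commute flip: power_mult power_add)
  ultimately show ?thesis by simp
qed

text \<open>Otherwise than in the trivial case, the geometric sum times the unit
  \<open>t^j - 1\<close> telescopes to \<open>(t^j)^(4*N) - 1\<close>, which is 0 modulo
  \<open>p^2\<close>.\<close>

lemma power_sum: "[(\<Sum>k<4*N. (t ^ k) ^ j) = (if 4 * N dvd j then int (4 * N) else 0)] (mod int p ^ 2)"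
proof (cases "4 * N dvd j")
  case True
  then obtain q where q: "j = 4 * N * q" by auto
  have "[(\<Sum>k<4*N. (t ^ k) ^ j) = (\<Sum>k<4*N. (1::int))] (mod int p ^ 2)"
  proof (rule cong_sum)
    fix k
    have "[(t ^ (4 * N)) ^ (k * q) = 1 ^ (k * q)] (mod int p ^ 2)" by (intro cong_pow t_pow_4N)
    then show "[(t ^ k) ^ j = 1] (mod int p ^ 2)" by (simp add: q mult_ac flip: power_mult)
  qed
  then show ?thesis using True by simp
next
  case False
  have "(\<Sum>k<4*N. (t ^ k) ^ j) = (\<Sum>k<4*N. (t ^ j) ^ k)"
    by (simp add: mult.commute flip: power_mult)
  then have "(t ^ j - 1) * (\<Sum>k<4*N. (t ^ k) ^ j) = (t ^ j) ^ (4*N) - 1"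
    by (simp add: power_diff_1_eq)
  moreover have "[(t ^ j) ^ (4*N) - 1 = 0] (mod int p ^ 2)"
    using cong_pow[OF t_pow_4N, of j] by (simp add: cong_diff_iff_cong_0 mult.commute flip: power_mult)
  ultimately have "int p ^ 2 dvd (t ^ j - 1) * (\<Sum>k<4*N. (t ^ k) ^ j)" by (simp add: cong_0_iff)
  moreover have "coprime (int p ^ 2) (t ^ j - 1)"
    using False t_pow_cong_1_iff[of j] by (simp add: coprime_iff coprime_commute[of "int p"] cong_iff_dvd_diff)
  ultimately show ?thesis using False by (simp add: cong_0_iff coprime_dvd_mult_right_iff)
qed

text \<open>The Jacobi sum of a quartic and the quadratic character modulo \<open>p\<^sup>2\<close>, over the
  Teichmueller representatives: their power sums vanish exactly.\<close>
definition J :: int where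
  "J = (\<Sum>k<4*N. (t ^ k) ^ (3*N) * (1 - t ^ k) ^ (2*N*p))"

text \<open>The correction divisible by \<open>p\<close> that enters \<open>2 * J\<close> and
  \<open>2 * P\<close> with opposite signs.\<close>

definition esum :: int where
  "esum = (\<Sum>i<N. (-1) ^ i * int (2*N choose i) * e (N - i))"

lemma dvd_esum: "int p dvd esum"
  unfolding esum_def using p_eq by (intro dvd_sum dvd_mult dvd_e) auto

text \<open>The alternating sum over row \<open>2 * N\<close> is 0, and it is symmetric about its
  middle term.\<close>

lemma alternating_half_sum:
  "2 * (\<Sum>i<N. (-1) ^ i * int (2*N choose i)) = - ((-1) ^ N * int (2*N choose N))"
proof -
  define f where "f i = (-1) ^ i * int (2*N choose i)" for i
  have refl: "f (2*N - i) = f i" if "i \<le> 2*N" for i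
  proof -
    have "even (2*N - i) \<longleftrightarrow> even i" using that by presburger
    then show ?thesis using that
      by (simp add: f_def binomial_symmetric[of i "2*N"] minus_one_power_iff)
  qed
  have "0 = (\<Sum>i\<le>2*N. f i)"
    unfolding f_def using choose_alternating_sum[of "2*N", where 'a = int] N_pos by simp
  also have "{..2*N} = {..<N} \<union> {N} \<union> {N<..2*N}" by auto
  also have "(\<Sum>i\<in>\<dots>. f i) = (\<Sum>i<N. f i) + f N + (\<Sum>i\<in>{N<..2*N}. f i)"
    by (subst sum.union_disjoint; (subst sum.union_disjoint)?; auto)
  also have "(\<Sum>i\<in>{N<..2*N}. f i) = (\<Sum>i<N. f i)"
    by (rule sum.reindex_bij_witness[of _ "\<lambda>i. 2*N - i" "\<lambda>i. 2*N - i"]) (auto simp: refl)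
  finally show ?thesis by (simp add: f_def)
qed

text \<open>The exponent lies between \<open>3*N\<close> and \<open>5*N\<close>, where
  \<open>4*N\<close> is the only multiple.\<close>

lemma dvd_iff_main: "i \<le> 2*N \<Longrightarrow> 4*N dvd 3*N + i \<longleftrightarrow> i = N"
proof
  assume "i \<le> 2*N" "4*N dvd 3*N + i"
  then obtain q where q: "3*N + i = 4*N*q" by auto
  have "q = 1"
  proof (rule ccontr)
    assume "q \<noteq> 1"
    then have "q = 0 \<or> q \<ge> 2" by auto
    then show False
    proof
      assume "q \<ge> 2"
      then have "4*N*2 \<le> 4*N*q" by (rule mult_le_mono2)
      then show False using q \<open>i \<le> 2*N\<close> N_pos by linarith
    qed (use q N_pos in auto)
  qed
  then show "i = N" using q by simp
qed auto

text \<open>The exponent lies strictly between \<open>3*N\<close> and \<open>9*N\<close>, so it is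
  \<open>4*N\<close> or \<open>8*N\<close>; the bounds on \<open>r\<close> assign the first to
  \<open>i < N\<close> and the second to the other \<open>i\<close>.\<close>

lemma dvd_iff_error:
  assumes "i < 2*N" "r \<in> {1..<p}"
  shows "4*N dvd 3*N + r + i \<longleftrightarrow> r = (if i < N then N - i else 5*N - i)"
proof
  assume "4*N dvd 3*N + r + i"
  then obtain q where q: "3*N + r + i = 4*N*q" by auto
  have "q \<noteq> 0" using q N_pos by (intro notI) simp
  moreover have "q < 3"
  proof (rule ccontr)
    assume "\<not> q < 3"
    then have "4*N*3 \<le> 4*N*q" by (intro mult_le_mono2) simp
    then show False using q assms N_pos p_eq unfolding atLeastLessThan_iff by linarith
  qed
  ultimately have "q = 1 \<or> q = 2" by auto
  then show "r = (if i < N then N - i else 5*N - i)" using q assms p_eq by auto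
next
  assume "r = (if i < N then N - i else 5*N - i)"
  then have "3*N + r + i = 4*N \<or> 3*N + r + i = 4*N*2" using assms by (auto split: if_splits)
  then show "4*N dvd 3*N + r + i" by (metis dvd_refl dvd_triv_left)
qed

text \<open>Expand \<open>J\<close> by \<open>one_minus_pow_np\<close> and sum over \<open>k\<close>
  first: by \<open>power_sum\<close> only exponents divisible by \<open>4 * N\<close>
  survive.\<close>

lemma J_cong_sum_e: "[J = int (4*N) * (-1) ^ N * int (2*N choose N)
   + int (4*N) * (\<Sum>i<N. (-1) ^ i * int (2*N - 1 choose i) * e (N - i))] (mod int p ^ 2)"
proof -
  define c where "c i = int (2*N choose i) * (-1) ^ i" for i
  define d where "d i = (-1) ^ i * int (2*N - 1 choose i)" for i
  have "[J = (\<Sum>k<4*N. (t ^ k) ^ (3*N) * ((1 - t ^ k) ^ (2*N)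
     - int (2*N) * (1 - t ^ k) ^ (2*N - 1) * (\<Sum>r\<in>{1..<p}. e r * (t ^ k) ^ r)))] (mod int p ^ 2)"
    unfolding J_def by (intro cong_sum cong_mult cong_refl one_minus_pow_np t_pow_frob)
  also have "(\<Sum>k<4*N. (t ^ k) ^ (3*N) * ((1 - t ^ k) ^ (2*N)
     - int (2*N) * (1 - t ^ k) ^ (2*N - 1) * (\<Sum>r\<in>{1..<p}. e r * (t ^ k) ^ r)))
    = (\<Sum>k<4*N. (\<Sum>i\<le>2*N. c i * (t ^ k) ^ (3*N + i))
        - int (2*N) * (\<Sum>r\<in>{1..<p}. \<Sum>i\<le>2*N-1. e r * d i * (t ^ k) ^ (3*N + r + i)))"
  proof (intro sum.cong refl)
    fix k
    define x where "x = t ^ k"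
    have "x ^ (3*N) * ((\<Sum>r\<in>{1..<p}. e r * x ^ r) * (\<Sum>i\<le>2*N-1. d i * x ^ i))
        = (\<Sum>r\<in>{1..<p}. \<Sum>i\<le>2*N-1. e r * d i * x ^ (3*N + r + i))"
      unfolding sum_product unfolding sum_distrib_left by (simp add: power_add mult_ac)
    moreover have "x ^ (3*N) * (1 - x) ^ (2*N) = (\<Sum>i\<le>2*N. c i * x ^ (3*N + i))"
      unfolding one_minus_power_expand c_def sum_distrib_left by (simp add: power_add mult_ac)
    moreover have "(1 - x) ^ (2*N - 1) = (\<Sum>i\<le>2*N-1. d i * x ^ i)"
      unfolding one_minus_power_expand d_def by (simp add: mult_ac)
    ultimately show "(t ^ k) ^ (3*N) * ((1 - t ^ k) ^ (2*N)
     - int (2*N) * (1 - t ^ k) ^ (2*N - 1) * (\<Sum>r\<in>{1..<p}. e r * (t ^ k) ^ r))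
    = (\<Sum>i\<le>2*N. c i * (t ^ k) ^ (3*N + i))
        - int (2*N) * (\<Sum>r\<in>{1..<p}. \<Sum>i\<le>2*N-1. e r * d i * (t ^ k) ^ (3*N + r + i))"
      unfolding x_def[symmetric] by (simp only: right_diff_distrib mult_ac)
  qed
  also have "\<dots> = (\<Sum>i\<le>2*N. c i * (\<Sum>k<4*N. (t ^ k) ^ (3*N + i)))
      - int (2*N) * (\<Sum>r\<in>{1..<p}. \<Sum>i\<le>2*N-1. e r * d i * (\<Sum>k<4*N. (t ^ k) ^ (3*N + r + i)))"
  proof -
    have "(\<Sum>k<4*N. \<Sum>i\<le>2*N. c i * (t ^ k) ^ (3*N + i)) = (\<Sum>i\<le>2*N. c i * (\<Sum>k<4*N. (t ^ k) ^ (3*N + i)))"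
      unfolding sum_distrib_left by (rule sum.swap)
    moreover have "(\<Sum>k<4*N. \<Sum>r\<in>{1..<p}. \<Sum>i\<le>2*N-1. e r * d i * (t ^ k) ^ (3*N + r + i))
        = (\<Sum>r\<in>{1..<p}. \<Sum>k<4*N. \<Sum>i\<le>2*N-1. e r * d i * (t ^ k) ^ (3*N + r + i))"
      by (rule sum.swap)
    moreover have "\<dots> = (\<Sum>r\<in>{1..<p}. \<Sum>i\<le>2*N-1. e r * d i * (\<Sum>k<4*N. (t ^ k) ^ (3*N + r + i)))"
      unfolding sum_distrib_left by (intro sum.cong refl sum.swap)
    ultimately show ?thesis by (simp only: sum_subtractf flip: sum_distrib_left)
  qed
  also have "[(\<Sum>i\<le>2*N. c i * (\<Sum>k<4*N. (t ^ k) ^ (3*N + i)))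
      - int (2*N) * (\<Sum>r\<in>{1..<p}. \<Sum>i\<le>2*N-1. e r * d i * (\<Sum>k<4*N. (t ^ k) ^ (3*N + r + i)))
     = (\<Sum>i\<le>2*N. c i * (if 4*N dvd 3*N + i then int (4*N) else 0))
      - int (2*N) * (\<Sum>r\<in>{1..<p}. \<Sum>i\<le>2*N-1. e r * d i * (if 4*N dvd 3*N + r + i then int (4*N) else 0))]
      (mod int p ^ 2)"
    by (intro cong_diff cong_sum cong_mult cong_refl power_sum)
  also have "(\<Sum>i\<le>2*N. c i * (if 4*N dvd 3*N + i then int (4*N) else 0))
      = (\<Sum>i\<le>2*N. if i = N then c i * int (4*N) else 0)"
    by (intro sum.cong refl) (simp only: dvd_iff_main atMost_iff mult_zero_right split: if_split, simp)
  also have "\<dots> = int (4*N) * (-1) ^ N * int (2*N choose N)"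
    by (simp add: c_def)
  also have "(\<Sum>r\<in>{1..<p}. \<Sum>i\<le>2*N-1. e r * d i * (if 4*N dvd 3*N + r + i then int (4*N) else 0))
      = int (4*N) * (\<Sum>i<2*N. d i * e (if i < N then N - i else 5*N - i))"
  proof -
    have "{..2*N-1} = {..<2*N}" using N_pos by auto
    then have "(\<Sum>r\<in>{1..<p}. \<Sum>i\<le>2*N-1. e r * d i * (if 4*N dvd 3*N + r + i then int (4*N) else 0))
      = (\<Sum>i<2*N. \<Sum>r\<in>{1..<p}. e r * d i * (if 4*N dvd 3*N + r + i then int (4*N) else 0))"
      by (simp only: sum.swap[of _ "{1..<p}"])
    also have "\<dots> = (\<Sum>i<2*N. \<Sum>r\<in>{1..<p}.
        if r = (if i < N then N - i else 5*N - i) then e r * d i * int (4*N) else 0)"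
      by (intro sum.cong refl, subst dvd_iff_error) auto
    also have "\<dots> = (\<Sum>i<2*N. int (4*N) * (d i * e (if i < N then N - i else 5*N - i)))"
    proof (intro sum.cong refl)
      fix i assume "i \<in> {..<2*N}"
      then have "(if i < N then N - i else 5*N - i) \<in> {1..<p}" using p_eq by auto
      then show "(\<Sum>r\<in>{1..<p}. if r = (if i < N then N - i else 5*N - i) then e r * d i * int (4*N) else 0)
          = int (4*N) * (d i * e (if i < N then N - i else 5*N - i))"
        by (subst sum.delta) (simp_all add: mult_ac)
    qed
    finally show ?thesis by (simp add: sum_distrib_left)
  qed
  \<comment> \<open>Under \<open>i -> 2*N - 1 - i\<close> both \<open>d\<close> and \<open>e\<close>
    change sign, so the two halves agree.\<close>
  also have "(\<Sum>i<2*N. d i * e (if i < N then N - i else 5*N - i)) = 2 * (\<Sum>i<N. d i * e (N - i))"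
  proof -
    have "{..<2*N} = {..<N} \<union> {N..<2*N}" by auto
    then have "(\<Sum>i<2*N. d i * e (if i < N then N - i else 5*N - i))
        = (\<Sum>i<N. d i * e (N - i)) + (\<Sum>i\<in>{N..<2*N}. d i * e (5*N - i))"
      by (simp add: sum.union_disjoint ivl_disj_int)
    also have "(\<Sum>i\<in>{N..<2*N}. d i * e (5*N - i)) = (\<Sum>i<N. d i * e (N - i))"
    proof (rule sum.reindex_bij_witness[of _ "\<lambda>i. 2*N - 1 - i" "\<lambda>i. 2*N - 1 - i"])
      fix i assume i: "i \<in> {N..<2*N}"
      have "even (2*N - 1 - i) \<longleftrightarrow> odd i" using i unfolding atLeastLessThan_iff by presburger
      moreover have le: "i \<le> 2*N - 1" using i by auto
      ultimately have "d (2*N - 1 - i) = - d i"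
        using binomial_symmetric[OF le] by (simp add: d_def minus_one_power_iff)
      moreover have "e (5*N - i) = - e (N - (2*N - 1 - i))"
      proof -
        have "5*N - i = p - (N - (2*N - 1 - i))" using i p_eq by auto
        then show ?thesis using e_reflect[of "N - (2*N - 1 - i)"] p_eq by (simp only:)
      qed
      ultimately show "d (2*N - 1 - i) * e (N - (2*N - 1 - i)) = d i * e (5*N - i)" by simp
    qed auto
    finally show ?thesis by simp
  qed
  \<comment> \<open>The sum is a multiple of \<open>p\<close>, so its coefficient matters only
    modulo \<open>p\<close>, where \<open>-4*N\<close> is 1.\<close>
  also have "[int (4*N) * (-1) ^ N * int (2*N choose N)
      - int (2*N) * (int (4*N) * (2 * (\<Sum>i<N. d i * e (N - i))))
    = int (4*N) * (-1) ^ N * int (2*N choose N) + int (4*N) * (\<Sum>i<N. d i * e (N - i))] (mod int p ^ 2)"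
  proof -
    have "int p dvd (\<Sum>i<N. d i * e (N - i))"
      using p_eq by (intro dvd_sum dvd_mult dvd_e) auto
    then obtain q where q: "(\<Sum>i<N. d i * e (N - i)) = int p * q" by auto
    have "int (4*N) * (int p * q) + int (2*N) * (int (4*N) * (2 * (int p * q))) = int p ^ 2 * (int (4*N) * q)"
      by (simp add: int_p_eq power2_eq_square algebra_simps)
    then have "[int (4*N) * (int p * q) = - (int (2*N) * (int (4*N) * (2 * (int p * q))))] (mod int p ^ 2)"
      unfolding cong_uminus_iff_dvd_add by (simp only: dvd_triv_left)
    from cong_add[OF cong_refl cong_sym[OF this]] show ?thesis
      unfolding q by (simp only: diff_conv_add_uminus)
  qed
  finally show ?thesis by (simp only: d_def)
qed

text \<open>Absorption turns row \<open>2*N - 1\<close> into row \<open>2*N\<close> at the cost of a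
  factor \<open>N + (N - i)\<close>. The part \<open>N\<close> yields \<open>esum\<close>; the part
  \<open>N - i\<close> cancels against \<open>e (N - i)\<close>, leaving \<open>p\<close> times
  \<open>alternating_half_sum\<close>.\<close>

lemma J_cong_binomial: "[2 * J = - 2 * (-1) ^ N * int (2*N choose N) - esum] (mod int p ^ 2)"
proof -
  have summand: "[int (4*N) * ((-1) ^ i * int (2*N - 1 choose i) * e (N - i))
      = int (2*N) * ((-1) ^ i * int (2*N choose i) * e (N - i))
        + int p * (2 * ((-1) ^ i * int (2*N choose i)))] (mod int p ^ 2)" if "i < N" for i
  proof -
    have "(2*N - i) * (2*N choose i) = 2*N * ((2*N - 1) choose i)" by (rule binomial_absorb_comp)
    moreover have "2*N - i = N + (N - i)" using that by simp
    ultimately have "int (2*N) * int ((2*N - 1) choose i) = int (N + (N - i)) * int (2*N choose i)"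
      by (metis of_nat_mult)
    then have "int (4*N) * ((-1) ^ i * int (2*N - 1 choose i) * e (N - i))
        = 2 * (-1) ^ i * (int (N + (N - i)) * int (2*N choose i)) * e (N - i)"
      by (simp add: mult_ac)
    also have "\<dots> = int (2*N) * ((-1) ^ i * int (2*N choose i) * e (N - i))
        + 2 * (-1) ^ i * int (2*N choose i) * (int (N - i) * e (N - i))"
      by (simp add: algebra_simps)
    also have "[\<dots> = int (2*N) * ((-1) ^ i * int (2*N choose i) * e (N - i))
        + 2 * (-1) ^ i * int (2*N choose i) * int p] (mod int p ^ 2)"
      using that p_eq by (intro cong_add cong_mult cong_refl mult_e) auto
    finally show ?thesis by (simp add: mult_ac)
  qed
  have "[J = int (4*N) * (-1) ^ N * int (2*N choose N)
   + (\<Sum>i<N. int (4*N) * ((-1) ^ i * int (2*N - 1 choose i) * e (N - i)))] (mod int p ^ 2)"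
    using J_cong_sum_e by (simp add: sum_distrib_left)
  also have "[int (4*N) * (-1) ^ N * int (2*N choose N)
   + (\<Sum>i<N. int (4*N) * ((-1) ^ i * int (2*N - 1 choose i) * e (N - i)))
    = int (4*N) * (-1) ^ N * int (2*N choose N)
   + (\<Sum>i<N. int (2*N) * ((-1) ^ i * int (2*N choose i) * e (N - i))
        + int p * (2 * ((-1) ^ i * int (2*N choose i))))] (mod int p ^ 2)"
    by (intro cong_add cong_refl cong_sum summand) simp
  also have "int (4*N) * (-1) ^ N * int (2*N choose N)
   + (\<Sum>i<N. int (2*N) * ((-1) ^ i * int (2*N choose i) * e (N - i))
        + int p * (2 * ((-1) ^ i * int (2*N choose i))))
    = int (4*N) * (-1) ^ N * int (2*N choose N) + int (2*N) * esum
      + int p * (2 * (\<Sum>i<N. (-1) ^ i * int (2*N choose i)))"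
    by (simp only: esum_def sum.distrib sum_distrib_left add.assoc)
  also have "\<dots> = - ((-1) ^ N * int (2*N choose N)) + int (2*N) * esum"
    unfolding alternating_half_sum by (simp add: p_eq algebra_simps)
  finally have "[2 * J = 2 * (- ((-1) ^ N * int (2*N choose N)) + int (2*N) * esum)] (mod int p ^ 2)"
    by (intro cong_mult cong_refl)
  also have "[2 * (- ((-1) ^ N * int (2*N choose N)) + int (2*N) * esum)
      = - 2 * (-1) ^ N * int (2*N choose N) - esum] (mod int p ^ 2)"
  proof -
    obtain q where q: "esum = int p * q" using dvd_esum by auto
    have "2 * (int (2*N) * esum) + esum = int p ^ 2 * q"
      by (simp add: q int_p_eq power2_eq_square algebra_simps)
    then show ?thesis by (simp add: cong_iff_dvd_diff algebra_simps)
  qed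
  finally show ?thesis .
qed

text \<open>Shifting \<open>m\<close> by \<open>2*N\<close> replaces \<open>t^m\<close> by its
  negative, under which the summand is invariant; half a period therefore gives half of the sum over
  nonzero residues.\<close>

lemma sum_t_pow_half:
  fixes c :: int
  shows "2 * (\<Sum>m<2*N. rho (t ^ m) * rho (1 - c * t ^ (2*m))) = (\<Sum>x\<in>R. rho x * rho (c * x\<^sup>2 - 1))"
proof -
  define f where "f m = rho (t ^ m) * rho (c * (t ^ m)\<^sup>2 - 1)" for m
  have period: "f (2*N + m) = f m" for m
  proof -
    have "[t ^ (4 * N) * t ^ (2 * m) = 1 * t ^ (2 * m)] (mod int p)"
      by (intro cong_mult cong_refl cong_dvd_modulus[OF t_pow_4N]) simp
    then have "rho (c * (t ^ (2*N+m))\<^sup>2 - 1) = rho (c * (t ^ m)\<^sup>2 - 1)"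
      by (intro rho_cong cong_diff cong_mult cong_refl)
         (simp add: algebra_simps flip: power_mult power_add)
    then show ?thesis by (simp add: f_def rho_t_pow minus_one_power_iff)
  qed
  have "(\<Sum>x\<in>R. rho x * rho (c * x\<^sup>2 - 1)) = (\<Sum>x\<in>R - {0}. rho x * rho (c * x\<^sup>2 - 1))"
    by (simp add: sum_R_minus_0)
  also have "\<dots> = (\<Sum>m<4*N. f m)"
    unfolding f_def
    by (rule sum_t_pow[symmetric])
       (auto intro!: arg_cong2[where f = "(*)"] rho_cong cong_diff cong_pow cong_mult)
  also have "{..<4*N} = {..<2*N} \<union> {2*N..<4*N}" by auto
  also have "(\<Sum>m\<in>\<dots>. f m) = (\<Sum>m<2*N. f m) + (\<Sum>m\<in>{2*N..<4*N}. f m)"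
    by (rule sum.union_disjoint) auto
  also have "(\<Sum>m\<in>{2*N..<4*N}. f m) = (\<Sum>m<2*N. f m)"
  proof (rule sum.reindex_bij_witness[of _ "\<lambda>m. 2*N + m" "\<lambda>m. m - 2*N"])
    fix m assume "m \<in> {2*N..<4*N}"
    then show "f (m - 2*N) = f m" using period[of "m - 2*N"] by simp
  qed auto
  finally show ?thesis
    by (simp add: f_def rho_diff_commute[of 1] mult.commute flip: power_mult)
qed

text \<open>Substituting \<open>c * x\<close> in \<open>S c\<close> pulls out \<open>rho c\<close>
  twice.\<close>

lemma sum_rho_dual: "\<not> int p dvd c \<Longrightarrow> (\<Sum>x\<in>R. rho x * rho (c * x\<^sup>2 - 1)) = S c"
proof -
  assume c: "\<not> int p dvd c"
  have "S c = (\<Sum>x\<in>R. rho (c * x) * rho ((c * x)\<^sup>2 - c))"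
    unfolding S_def
    by (rule sum_scale[where f = "\<lambda>x. rho x * rho (x\<^sup>2 - c)", symmetric, OF c])
       (auto intro!: arg_cong2[where f = "(*)"] rho_cong cong_diff cong_pow)
  also have "\<dots> = (\<Sum>x\<in>R. rho x * rho (c * x\<^sup>2 - 1))"
  proof (intro sum.cong refl)
    fix x
    have "(c * x)\<^sup>2 - c = c * (c * x\<^sup>2 - 1)" by (simp add: power2_eq_square algebra_simps)
    then have "rho (c * x) * rho ((c * x)\<^sup>2 - c) = (rho c * rho c) * (rho x * rho (c * x\<^sup>2 - 1))"
      by (simp add: rho_mult mult_ac)
    then show "rho (c * x) * rho ((c * x)\<^sup>2 - c) = rho x * rho (c * x\<^sup>2 - 1)"
      by (simp add: rho_square[OF c])
  qed
  finally show ?thesis by simp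
qed

text \<open>Split by the parity of \<open>k\<close>: on even powers the quartic character
  \<open>x^(3*N)\<close> reduces to \<open>rho (t ^ m)\<close>, since \<open>t^(2*N)\<close> is -1;
  odd powers carry an extra \<open>t^(3*N)\<close>.\<close>

lemma J_cong_S: "[2 * J = S 1 + t ^ (3*N) * S t] (mod int p ^ 2)"
proof -
  have six: "[t ^ (6*N*m) = rho (t ^ m)] (mod int p ^ 2)" for m
  proof -
    have "[(t ^ (2*N)) ^ (3*m) = (-1) ^ (3*m)] (mod int p ^ 2)" by (intro cong_pow t_pow_2N)
    moreover have "(t ^ (2*N)) ^ (3*m) = t ^ (6*N*m)" by (simp add: mult_ac flip: power_mult)
    ultimately show ?thesis by (simp add: rho_t_pow minus_one_power_iff)
  qed
  have "[J = (\<Sum>k<4*N. (t ^ k) ^ (3*N) * rho (1 - t ^ k))] (mod int p ^ 2)"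
    unfolding J_def by (intro cong_sum cong_mult cong_refl rho_pow_p)
  also have "(\<Sum>k<4*N. (t ^ k) ^ (3*N) * rho (1 - t ^ k))
      = (\<Sum>m<2*N. t ^ (6*N*m) * rho (1 - 1 * t ^ (2*m)) + t ^ (3*N) * (t ^ (6*N*m) * rho (1 - t * t ^ (2*m))))"
    unfolding sum_even_odd
    by (intro sum.cong refl) (simp add: algebra_simps flip: power_mult power_add)
  also have "[(\<Sum>m<2*N. t ^ (6*N*m) * rho (1 - 1 * t ^ (2*m)) + t ^ (3*N) * (t ^ (6*N*m) * rho (1 - t * t ^ (2*m))))
    = (\<Sum>m<2*N. rho (t ^ m) * rho (1 - 1 * t ^ (2*m)) + t ^ (3*N) * (rho (t ^ m) * rho (1 - t * t ^ (2*m))))]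
      (mod int p ^ 2)"
    by (intro cong_sum cong_add cong_mult cong_refl six)
  finally have "[2 * J = 2 * (\<Sum>m<2*N. rho (t ^ m) * rho (1 - 1 * t ^ (2*m))
      + t ^ (3*N) * (rho (t ^ m) * rho (1 - t * t ^ (2*m))))] (mod int p ^ 2)"
    by (intro cong_mult cong_refl)
  also have "2 * (\<Sum>m<2*N. rho (t ^ m) * rho (1 - 1 * t ^ (2*m))
      + t ^ (3*N) * (rho (t ^ m) * rho (1 - t * t ^ (2*m))))
    = 2 * (\<Sum>m<2*N. rho (t ^ m) * rho (1 - 1 * t ^ (2*m)))
      + t ^ (3*N) * (2 * (\<Sum>m<2*N. rho (t ^ m) * rho (1 - t * t ^ (2*m))))"
    by (simp only: sum.distrib sum_distrib_left distrib_left mult_ac)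
  also have "\<dots> = S 1 + t ^ (3*N) * S t"
    unfolding sum_t_pow_half using t_not_dvd p_gt prime_int_p not_prime_unit
    by (subst (1 2) sum_rho_dual) auto
  finally show ?thesis .
qed

section \<open>The Legendre polynomial at 3\<close>

lemma coprime_sqI: "\<not> int p dvd x \<Longrightarrow> coprime x (int p ^ 2)"
  by (simp add: coprime_iff)

lemma not_dvd_small: "0 < k \<Longrightarrow> k < p \<Longrightarrow> \<not> int p dvd int k"
  by (auto simp: int_dvd_int_iff dest: dvd_imp_le)

lemma choose_p_add: "j < p \<Longrightarrow> [int (p + j choose j) = 1] (mod int p)"
proof (induction j)
  case (Suc j)
  have "Suc j * (p + Suc j choose Suc j) = (p + Suc j) * (p + j choose j)"
    using binomial_absorption[of j "p + Suc j"] by simp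
  then have "int (Suc j) * int (p + Suc j choose Suc j) = (int p + int (Suc j)) * int (p + j choose j)"
    by (metis of_nat_add of_nat_mult)
  also have "[\<dots> = (0 + int (Suc j)) * 1] (mod int p)"
    using Suc by (intro cong_mult cong_add cong_refl) (auto simp: cong_0_iff)
  finally have "[int (Suc j) * int (p + Suc j choose Suc j) = int (Suc j) * 1] (mod int p)" by simp
  moreover have "coprime (int (Suc j)) (int p)"
    using Suc.prems by (intro coprime_iff[THEN iffD2] not_dvd_small) auto
  ultimately show ?case by (simp only: cong_mult_lcancel)
qed simp

lemma mult_choose_p: "0 < m \<Longrightarrow> m < p \<Longrightarrow> [int m * int (p - 1 + m choose m) = int p] (mod int p ^ 2)"
proof -
  assume m: "0 < m" "m < p"
  have "m * (p - 1 + m choose m) = p * (p + (m - 1) choose (m - 1))"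
  proof -
    have "Suc (m - 1) = m" "Suc (m - 1 + (p - 1)) = p - 1 + m" "Suc (p - 1) = p" "p + (m - 1) = p - 1 + m"
      using m by auto
    then show ?thesis using Suc_times_binomial_add[of "m - 1" "p - 1"] by (simp only:)
  qed
  then have *: "int m * int (p - 1 + m choose m) = int p * int (p + (m - 1) choose (m - 1))"
    by (metis of_nat_mult)
  have "int p * int p dvd int p * (int (p + (m - 1) choose (m - 1)) - 1)"
    using choose_p_add[of "m - 1"] m by (intro mult_dvd_mono) (simp_all only: cong_iff_dvd_diff dvd_refl)
  then show ?thesis unfolding *
    by (simp only: cong_iff_dvd_diff power2_eq_square right_diff_distrib mult_1_right)
qed

text \<open>With \<open>p - 1 = 4*N\<close>, the binomial represents \<open>p / (2*s)\<close> and
  \<open>e s\<close> represents \<open>p / s\<close>; cancel the unit \<open>s\<close>.\<close>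

lemma choose_p_cong_e: "0 < s \<Longrightarrow> s \<le> N \<Longrightarrow> [2 * int (4*N + 2*s choose (2*s)) = e s] (mod int p ^ 2)"
proof -
  assume s: "0 < s" "s \<le> N"
  have "[int (2*s) * int (p - 1 + 2*s choose (2*s)) = int p] (mod int p ^ 2)"
    using s p_eq by (intro mult_choose_p) auto
  moreover have "[int s * e s = int p] (mod int p ^ 2)" using s p_eq by (intro mult_e) auto
  ultimately have "[int (2*s) * int (p - 1 + 2*s choose (2*s)) = int s * e s] (mod int p ^ 2)"
    using cong_trans cong_sym by blast
  then have "[int s * (2 * int (4*N + 2*s choose (2*s))) = int s * e s] (mod int p ^ 2)"
    using p_eq by (simp add: mult_ac)
  then show ?thesis using coprime_sqI[OF not_dvd_small[of s]] s p_eq by (simp add: cong_mult_lcancel)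
qed

text \<open>The value of \<open>legendreP (2*N)\<close> at 3, where \<open>(x - 1) / 2\<close> is
  1.\<close>

definition P :: int where "P = (\<Sum>k\<le>2*N. int (2*N choose k) * int (2*N + k choose k))"

text \<open>In \<open>sum_choose_mult_choose\<close> the last term, \<open>k = N\<close>, is the
  central binomial coefficient; the others give \<open>esum\<close> with
  \<open>s = N - k\<close>.\<close>

lemma P_cong: "[2 * P = 2 * (-1) ^ N * int (2*N choose N) + esum] (mod int p ^ 2)"
proof -
  define f where "f k = (-1) ^ k * int (2*N choose k) * int (2*(2*N) + (2*N - 2*k) choose (2*N - 2*k))" for k
  have "P = (\<Sum>k\<le>N. f k)"
    unfolding P_def f_def by (subst sum_choose_mult_choose) simp
  also have "{..N} = insert N {..<N}" by auto
  also have "(\<Sum>k\<in>\<dots>. f k) = f N + (\<Sum>k<N. f k)" by simp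
  finally have "P = f N + (\<Sum>k<N. f k)" .
  moreover have "2 * f k = (-1) ^ k * int (2*N choose k) * (2 * int (4*N + 2*(N - k) choose (2*(N - k))))" for k
    unfolding f_def diff_mult_distrib2 by simp
  moreover have "f N = (-1) ^ N * int (2*N choose N)" by (simp add: f_def)
  ultimately have "2 * P = 2 * (-1) ^ N * int (2*N choose N)
      + (\<Sum>k<N. (-1) ^ k * int (2*N choose k) * (2 * int (4*N + 2*(N - k) choose (2*(N - k)))))"
    by (simp only: distrib_left sum_distrib_left mult.assoc)
  also have "[\<dots> = 2 * (-1) ^ N * int (2*N choose N) + esum] (mod int p ^ 2)"
    unfolding esum_def by (intro cong_add cong_refl cong_sum cong_mult choose_p_cong_e) auto
  finally show ?thesis .
qed

lemma P_cong_J: "[P = - J] (mod int p ^ 2)"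
proof -
  have "[2 * P + 2 * J = 2 * (-1) ^ N * int (2*N choose N) + esum + (- (2 * (-1) ^ N * int (2*N choose N)) - esum)]
     (mod int p ^ 2)"
    by (intro cong_add P_cong) (use J_cong_binomial in simp)
  then have "[2 * (P + J) = 2 * 0] (mod int p ^ 2)" by simp
  moreover have "coprime 2 (int p ^ 2)" using not_dvd_small[of 2] p_gt by (intro coprime_sqI) auto
  ultimately have "[P + J = 0] (mod int p ^ 2)" by (simp only: cong_mult_lcancel)
  then show ?thesis by (simp add: cong_0_iff cong_uminus_iff_dvd_add)
qed

text \<open>Modulo \<open>p\<close> the term \<open>esum\<close> drops out, and
  \<open>2*N choose N\<close> divides \<open>fact (2*N)\<close>, which is prime to
  \<open>p\<close>.\<close>

lemma not_dvd_J: "\<not> int p dvd J"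
proof
  assume "int p dvd J"
  moreover have "[2 * J = - 2 * (-1) ^ N * int (2*N choose N) - esum] (mod int p)"
    by (rule cong_dvd_modulus[OF J_cong_binomial]) simp
  ultimately have "int p dvd - 2 * (-1) ^ N * int (2*N choose N) - esum"
    using cong_dvd_iff by (metis dvd_mult)
  then have "int p dvd - 2 * (-1) ^ N * int (2*N choose N)" using dvd_esum by (metis dvd_diff_left_iff)
  then have "int p dvd int 2 * int (2*N choose N)" by (simp add: minus_one_power_iff split: if_splits)
  then have "p dvd 2 * (2*N choose N)" by (simp only: int_dvd_int_iff flip: of_nat_mult)
  moreover have "\<not> p dvd 2" using p_gt by (auto dest: dvd_imp_le)
  ultimately have "p dvd (2*N choose N)" using prime_p by (simp add: prime_dvd_mult_iff)
  then have "p dvd fact N * fact (2*N - N) * (2*N choose N)" by simp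
  then have "p dvd fact (2*N)" using binomial_fact_lemma[of N "2*N"] by simp
  then show False using prime_p p_eq by (simp add: prime_dvd_fact_iff)
qed

text \<open>\<open>S 1\<close> is twice an odd \<open>A\<close> with \<open>A = 2*N - 1\<close>
  modulo 4. Uniqueness of the two-square representation gives \<open>A = a\<close> or
  \<open>A = -a\<close>, and \<open>a = 1\<close> modulo 4 fixes the sign.\<close>

lemma S_1_eq:
  fixes a b :: int
  assumes "int p = a\<^sup>2 + b\<^sup>2" "[a = 1] (mod 4)"
  obtains B where "S 1 = 2 * (- ((-1) ^ N * a))" "S t = 2 * B" "int p = a\<^sup>2 + B\<^sup>2"
proof -
  obtain q where "S 1 - (int p - 3) = 8 * q" using S_1_cong by (auto simp: cong_iff_dvd_diff)
  then have A: "S 1 = 2 * (2 * int N - 1 + 4 * q)" using p_eq by simp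
  define A where "A = 2 * int N - 1 + 4 * q"
  have S1: "S 1 = 2 * A" using A by (simp add: A_def)
  then have "(S t)\<^sup>2 = 4 * (int p - A\<^sup>2)" using S_sum_squares by (simp add: power_mult_distrib)
  then have "even ((S t)\<^sup>2)" by simp
  then have "even (S t)" by simp
  then obtain B where B: "S t = 2 * B" by auto
  have AB: "int p = A\<^sup>2 + B\<^sup>2" using S_sum_squares by (simp add: S1 B power_mult_distrib)
  obtain r where r: "a = 1 + 4 * r" using assms(2) by (auto simp: cong_iff_dvd_diff algebra_simps elim!: dvdE)
  have "A\<^sup>2 = a\<^sup>2"
    using prime_p p_eq assms(1) AB by (intro sum_two_squares_odd_unique[of p a b A B]) (auto simp: A_def r)
  then have "A = a \<or> A = - a" by (simp add: power2_eq_iff)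
  have "A = - ((-1) ^ N * a)"
  proof (cases "even N")
    case True
    then obtain M where "N = 2 * M" by auto
    then have "A \<noteq> a" unfolding A_def r by simp presburger
    then show ?thesis using True \<open>A = a \<or> A = - a\<close> by simp
  next
    case False
    then obtain M where "N = 2 * M + 1" by (auto elim: oddE)
    then have "A \<noteq> - a" unfolding A_def r by simp presburger
    then show ?thesis using False \<open>A = a \<or> A = - a\<close> by simp
  qed
  then show ?thesis using that S1 B AB \<open>A\<^sup>2 = a\<^sup>2\<close> by simp
qed

text \<open>With \<open>i = t^(3 * N)\<close> a square root of \<open>-1\<close>, \<open>J\<close> and its conjugate \<open>J'\<close> satisfy
  \<open>J + J' = 2 * A\<close>, \<open>J * J' = p\<close>, and \<open>p\<close> divides \<open>J'\<close>; hence \<open>2 * A * J = 4 * A\<^sup>2 - p - J'\<^sup>2\<close>.\<close>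
lemma P_cong_a:
  fixes a b :: int
  assumes "int p = a\<^sup>2 + b\<^sup>2" "[a = 1] (mod 4)"
  shows "[P * (2 * a) = (-1) ^ N * (4 * a\<^sup>2 - int p)] (mod int p ^ 2)"
proof -
  obtain B where B: "S 1 = 2 * (- ((-1) ^ N * a))" "S t = 2 * B" "int p = a\<^sup>2 + B\<^sup>2"
    using S_1_eq[OF assms] by blast
  define A where "A = - ((-1) ^ N * a)"
  have A2: "A\<^sup>2 = a\<^sup>2" by (simp add: A_def power_mult_distrib minus_one_power_iff)
  define i where "i = t ^ (3*N)"
  have i2: "[i\<^sup>2 = -1] (mod int p ^ 2)"
    using cong_pow[OF t_pow_2N, of 3] by (simp add: i_def mult_ac flip: power_mult)
  have "[2 * J = 2 * (A + i * B)] (mod int p ^ 2)"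
    using J_cong_S B by (simp add: A_def i_def algebra_simps)
  moreover have "coprime 2 (int p ^ 2)" using not_dvd_small[of 2] p_gt by (intro coprime_sqI) auto
  ultimately have J: "[J = A + i * B] (mod int p ^ 2)" by (simp only: cong_mult_lcancel)
  define J' where "J' = 2 * A - J"
  have J': "[J' = A - i * B] (mod int p ^ 2)"
    using cong_diff[OF cong_refl J, of "2 * A"] by (simp add: J'_def)
  have "[J * J' = (A + i * B) * (A - i * B)] (mod int p ^ 2)" by (rule cong_mult[OF J J'])
  also have "(A + i * B) * (A - i * B) = A\<^sup>2 - i\<^sup>2 * B\<^sup>2" by (simp add: power2_eq_square algebra_simps)
  also have "[A\<^sup>2 - i\<^sup>2 * B\<^sup>2 = A\<^sup>2 - (-1) * B\<^sup>2] (mod int p ^ 2)"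
    by (intro cong_diff cong_mult cong_refl i2)
  also have "A\<^sup>2 - (-1) * B\<^sup>2 = int p" using A2 B(3) by simp
  finally have JJ': "[J * J' = int p] (mod int p ^ 2)" .
  then have "[J * J' = int p] (mod int p)" by (rule cong_dvd_modulus) simp
  then have "int p dvd J * J'" by (simp add: cong_dvd_iff)
  then have "int p dvd J'" using not_dvd_J prime_int_p by (simp add: prime_dvd_mult_iff)
  then have J'2: "[J' * J' = 0] (mod int p ^ 2)" by (simp add: cong_0_iff power2_eq_square mult_dvd_mono)
  have "J * (2 * A) = 4 * A\<^sup>2 - J * J' - J' * J'" by (simp add: J'_def power2_eq_square algebra_simps)
  also have "[\<dots> = 4 * A\<^sup>2 - int p - 0] (mod int p ^ 2)" by (intro cong_diff cong_refl JJ' J'2)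
  finally have JA: "[J * (2 * A) = 4 * A\<^sup>2 - int p] (mod int p ^ 2)" by simp
  have "- ((-1) ^ N) * A = a" by (simp add: A_def minus_one_power_iff)
  then have "P * (2 * a) = P * (2 * (- ((-1) ^ N) * A))" by simp
  also have "\<dots> = (- ((-1) ^ N)) * 2 * A * P" by (simp only: mult_ac)
  also have "[(- ((-1) ^ N)) * 2 * A * P = (- ((-1) ^ N)) * 2 * A * (- J)] (mod int p ^ 2)"
    by (intro cong_mult cong_refl P_cong_J)
  also have "(- ((-1) ^ N)) * 2 * A * (- J) = (-1) ^ N * (J * (2 * A))" by simp
  also have "[(-1) ^ N * (J * (2 * A)) = (-1) ^ N * (4 * A\<^sup>2 - int p)] (mod int p ^ 2)"
    by (intro cong_mult cong_refl JA)
  finally show ?thesis by (simp only: A2)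
qed

section \<open>Central binomial coefficients modulo \<open>p^2\<close>\<close>

text \<open>Both sides have the same successive quotients modulo \<open>p^2\<close>, because
  \<open>4 * (2*N + k + 1) * (2*N - k) = p^2 - (2*k + 1)^2\<close>. The denominators
  \<open>2*k + 1\<close> and \<open>2*k + 2\<close> stay below \<open>p\<close>.\<close>

lemma choose_2k_cong: "k \<le> 2*N \<Longrightarrow> [int (2*N + k choose (2*k)) * (-16) ^ k = int (2*k choose k)] (mod int p ^ 2)"
proof (induction k)
  case (Suc k)
  define X where "X = int (2*N + k choose (2*k)) * (-16) ^ k"
  define Y where "Y = int (2*N + Suc k choose (2 * Suc k)) * (-16) ^ Suc k"
  define c where "c = int ((2*k + 1) * (2*k + 2))"
  have "(2*k + 1) * (2*k + 2) * (2*N + Suc k choose (2 * Suc k))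
      = (2*N + k + 1) * ((2*k + 1) * (2*N + k choose (2*k + 1)))"
  proof -
    have "Suc (2*k + 1) = 2*k + 2" "2 * Suc k = 2*k + 2" "2*N + Suc k - 1 = 2*N + k" "2*N + Suc k = 2*N + k + 1"
      by auto
    then have "(2*k + 2) * (2*N + Suc k choose (2 * Suc k)) = (2*N + k + 1) * (2*N + k choose (2*k + 1))"
      using binomial_absorption[of "2*k + 1" "2*N + Suc k"] by (simp only:)
    then show ?thesis by (simp only: mult.assoc mult.left_commute)
  qed
  also have "(2*k + 1) * (2*N + k choose (2*k + 1)) = (2*N - k) * (2*N + k choose (2*k))"
  proof -
    have "Suc (2*k) = 2*k + 1" "Suc (2*N - k - 1) = 2*N - k" "Suc (2*k + (2*N - k - 1)) = 2*N + k"
      using Suc.prems by auto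
    then show ?thesis using Suc_times_binomial_add[of "2*k" "2*N - k - 1"] by (simp only:)
  qed
  finally have step: "c * int (2*N + Suc k choose (2 * Suc k)) = int (2*N + k + 1) * (int (2*N - k) * int (2*N + k choose (2*k)))"
    unfolding c_def by (metis of_nat_mult)
  have "c * Y = -16 * (int (2*N + k + 1) * int (2*N - k)) * X"
    unfolding X_def Y_def using step by simp
  also have "16 * (int (2*N + k + 1) * int (2*N - k)) = 4 * (int p ^ 2 - (2 * int k + 1)\<^sup>2)"
    using Suc.prems by (simp add: int_p_eq of_nat_diff power2_eq_square algebra_simps)
  then have "-16 * (int (2*N + k + 1) * int (2*N - k)) * X = - (4 * (int p ^ 2 - (2 * int k + 1)\<^sup>2)) * X"
    by simp
  also have "[\<dots> = - (4 * (0 - (2 * int k + 1)\<^sup>2)) * int (2*k choose k)] (mod int p ^ 2)"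
    unfolding X_def using Suc
    by (intro cong_mult cong_minus_minus_iff[THEN iffD2] cong_diff cong_refl) (auto simp: cong_0_iff)
  also have "- (4 * (0 - (2 * int k + 1)\<^sup>2)) * int (2*k choose k) = c * int (2 * Suc k choose Suc k)"
  proof -
    have "c * int (2 * Suc k choose Suc k) = 2 * (2 * int k + 1) * int ((k + 1) * (2 * Suc k choose Suc k))"
      by (simp add: c_def algebra_simps)
    also have "\<dots> = 4 * (2 * int k + 1)\<^sup>2 * int (2*k choose k)"
      unfolding central_choose_Suc by (simp add: power2_eq_square algebra_simps)
    finally show ?thesis by simp
  qed
  finally have "[c * Y = c * int (2 * Suc k choose Suc k)] (mod int p ^ 2)" .
  moreover have "coprime c (int p ^ 2)"
  proof -
    have "\<not> int p dvd int (2*k + 1)" "\<not> int p dvd int (2*k + 2)"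
      using Suc.prems p_eq by (intro not_dvd_small; simp)+
    then show ?thesis using prime_int_p unfolding c_def
      by (intro coprime_sqI) (simp only: of_nat_mult prime_dvd_mult_iff simp_thms)
  qed
  ultimately show ?case by (simp only: cong_mult_lcancel Y_def)
qed simp

lemma choose_square_cong:
  "k \<le> 2*N \<Longrightarrow> [int ((2*k choose k)\<^sup>2) = int (2*N choose k) * int (2*N + k choose k) * (-16) ^ k] (mod int p ^ 2)"
proof -
  assume k: "k \<le> 2*N"
  have "(2*N + k choose (2*k)) * (2*k choose k) = (2*N + k choose k) * (2*N choose k)"
    using choose_mult[of k "2*k" "2*N + k"] k by simp
  then have eq: "int (2*N + k choose (2*k)) * int (2*k choose k) = int (2*N choose k) * int (2*N + k choose k)"
    by (metis mult.commute of_nat_mult)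
  have "[int (2*N + k choose (2*k)) * (-16) ^ k * int (2*k choose k) = int (2*k choose k) * int (2*k choose k)]
      (mod int p ^ 2)"
    by (intro cong_mult cong_refl choose_2k_cong k)
  moreover have "int (2*N + k choose (2*k)) * (-16) ^ k * int (2*k choose k)
     = int (2*N choose k) * int (2*N + k choose k) * (-16) ^ k"
    unfolding eq[symmetric] by (simp only: mult_ac)
  ultimately show ?thesis by (simp add: power2_eq_square cong_sym)
qed

text \<open>Dividing \<open>choose_square_cong\<close> by \<open>y^k\<close> leaves
  \<open>z^k\<close>, which is the power in \<open>legendreP_eq\<close>.\<close>

lemma sum_rat_cong_legendreP:
  fixes y :: int and x :: rat
  assumes "\<not> int p dvd y" "-16 = y * z" "(x - 1) / 2 = of_int z"
  shows "rat_cong (int p) (int p ^ 2) (\<Sum>k=0..2*N. of_nat ((2*k choose k)\<^sup>2) / of_int y ^ k) (legendreP (2*N) x)"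
proof -
  have "rat_cong (int p) (int p ^ 2) (of_nat ((2*k choose k)\<^sup>2) / of_int y ^ k)
     (of_nat (2*N choose k) * of_nat (2*N + k choose k) * of_int z ^ k)" if "k \<in> {0..2*N}" for k
  proof -
    have "rat_cong (int p) (int p ^ 2) (of_int (int ((2*k choose k)\<^sup>2)) / of_int (y ^ k))
     (of_int (int (2*N choose k) * int (2*N + k choose k) * z ^ k) / of_int 1)"
    proof (rule rat_congI)
      show "\<not> int p dvd y ^ k" using assms(1) prime_int_p prime_dvd_power by blast
      show "\<not> int p dvd 1" using prime_int_p not_prime_unit by blast
      have "int (2*N choose k) * int (2*N + k choose k) * z ^ k * y ^ k
          = int (2*N choose k) * int (2*N + k choose k) * (-16) ^ k"
        unfolding assms(2) power_mult_distrib by (simp only: mult_ac)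
      then show "[int ((2*k choose k)\<^sup>2) * 1 = int (2*N choose k) * int (2*N + k choose k) * z ^ k * y ^ k] (mod int p ^ 2)"
        using choose_square_cong[of k] that by (simp only: mult_1_right atLeastAtMost_iff)
    qed (rule prime_int_p)
    then show ?thesis by simp
  qed
  then show ?thesis
    unfolding legendreP_eq assms(3) atLeast0AtMost by (intro rat_cong_sum prime_int_p) auto
qed

end

theorem theorem2p9:
  fixes p :: nat and a b :: int
  assumes "prime p" and "[p = 1] (mod 4)"
    and "int p = a^2 + b^2" and "[a = 1] (mod 4)"
  shows "rat_cong (int p) (int p ^ 2)
           (\<Sum>k = 0..(p-1) div 2. of_nat ((2*k choose k)^2) / 8 ^ k)
           (\<Sum>k = 0..(p-1) div 2. of_nat ((2*k choose k)^2) / (-16) ^ k)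
       \<and> rat_cong (int p) (int p ^ 2)
           (\<Sum>k = 0..(p-1) div 2. of_nat ((2*k choose k)^2) / (-16) ^ k)
           (legendreP ((p-1) div 2) (3::rat))
       \<and> rat_cong (int p) (int p ^ 2)
           (legendreP ((p-1) div 2) (3::rat))
           ((-1) ^ ((p-1) div 4) * (2 * of_int a - of_nat p / (2 * of_int a)))"
proof -
  have p1: "p \<ge> 1" using prime_gt_0_nat[OF assms(1)] by simp
  then have "4 dvd p - 1" using assms(2) by (simp add: cong_altdef_nat)
  then obtain N where "p - 1 = 4 * N" by auto
  then have pN: "p = 4 * N + 1" using p1 by simp
  interpret prime_1_mod_4 p N using assms(1) pN by unfold_locales
  have half: "(p - 1) div 2 = 2 * N" and quarter: "(p - 1) div 4 = N" using pN by simp_all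
  have nd2: "\<not> int p dvd 2" using not_dvd_small[of 2] p_gt by simp
  have nd: "\<not> int p dvd 8" "\<not> int p dvd -16"
    using nd2 prime_dvd_power[OF prime_int_p, of 2 3] prime_dvd_power[OF prime_int_p, of 2 4] by auto
  \<comment> \<open>Here \<open>8 * (-2) = -16\<close> and \<open>(-3 - 1) / 2 = -2\<close>; the
    even degree then turns -3 into 3.\<close>
  have s8: "rat_cong (int p) (int p ^ 2) (\<Sum>k=0..2*N. of_nat ((2*k choose k)^2) / 8 ^ k) (legendreP (2*N) 3)"
    using sum_rat_cong_legendreP[OF nd(1), of "-2" "-3"] by (simp add: legendreP_minus)
  have s16: "rat_cong (int p) (int p ^ 2) (\<Sum>k=0..2*N. of_nat ((2*k choose k)^2) / (-16) ^ k) (legendreP (2*N) 3)"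
    using sum_rat_cong_legendreP[OF nd(2), of 1 3] by simp
  \<comment> \<open>The denominator \<open>2 * a\<close> must be prime to \<open>p\<close>;
    otherwise \<open>p^2 \<le> a^2 \<le> p\<close>.\<close>
  have a: "\<not> int p dvd a"
  proof
    assume "int p dvd a"
    have "a \<noteq> 0" using assms(4) by (auto simp: cong_def)
    with \<open>int p dvd a\<close> have "int p \<le> \<bar>a\<bar>" using zdvd_imp_le[of "int p" "\<bar>a\<bar>"] by simp
    then have "(int p)\<^sup>2 \<le> a\<^sup>2" by (simp add: abs_le_square_iff[symmetric])
    also have "\<dots> \<le> int p" using assms(3) by simp
    finally show False using p_gt by (simp add: power2_eq_square)
  qed
  have "legendreP (2*N) (3::rat) = of_int P / of_int 1"
    by (simp add: legendreP_eq P_def)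
  moreover have "rat_cong (int p) (int p ^ 2) (of_int P / of_int 1)
      (of_int ((-1) ^ N * (4 * a\<^sup>2 - int p)) / of_int (2 * a))"
    using P_cong_a[OF assms(3,4)] a nd2 prime_int_p not_prime_unit[of "int p"]
    by (intro rat_congI) (auto simp: prime_dvd_mult_iff)
  moreover have "a \<noteq> 0" using a by auto
  then have "of_int ((-1) ^ N * (4 * a\<^sup>2 - int p)) / of_int (2 * a)
      = ((-1) ^ N * (2 * of_int a - of_nat p / (2 * of_int a)) :: rat)"
    by (simp add: field_simps power2_eq_square)
  ultimately have "rat_cong (int p) (int p ^ 2) (legendreP (2*N) (3::rat))
      ((-1) ^ N * (2 * of_int a - of_nat p / (2 * of_int a)))" by simp
  with s8 s16 show ?thesis unfolding half quarter
    using rat_cong_trans[OF prime_int_p s8 rat_cong_sym[OF prime_int_p s16]] by blast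
qed

end
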